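(* Let $\mathfrak{w},\widetilde{\mathfrak{w}}\colon\Omega\to G$ be multiplication algorithms on the irreducible symmetric cone $\Omega$, each satisfying the conditions A, B and C listed in the context, and let $\mathfrak{g}=\mathfrak{w}^{-1}$, $\widetilde{\mathfrak{g}}=\widetilde{\mathfrak{w}}^{-1}$ be the corresponding division algorithms. Assume that continuous functions $f,g,h,k\colon\mathcal{D}\to\mathbb{R}$ satisfy $$f(\mathbf{x})+g(\mathfrak{g}(\mathbf{e}-\mathbf{x})\mathbf{y})=h(\mathbf{y})+k(\widetilde{\mathfrak{g}}(\mathbf{e}-\mathbf{y})\mathbf{x}),\qquad(\mathbf{x},\mathbf{y})\in\mathcal{D}_0.$$ Then there exist real constants $C_1,C_2,C_3,C_4$ with $C_1+C_2=C_3+C_4$ and continuous functions $h_1,h_2,h_3\colon\Omega\to\mathbb{R}$ such that $h_1$ is both $\mathfrak{w}$-logarithmic and $\widetilde{\mathfrak{w}}$-logarithmic, $h_2$ is $\widetilde{\mathfrak{w}}$-logarithmic, $h_3$ is $\mathfrak{w}$-logarithmic, and for any $\mathbf{x}\in\mathcal{D}$, \begin{align*} f(\mathbf{x}) & = h_1(\mathbf{e}-\mathbf{x})+h_2(\mathbf{x})+h_3(\mathbf{e}-\mathbf{x})+C_1, \\ g(\mathbf{x}) & = h_1(\mathbf{e}-\mathfrak{w}(\mathbf{e})\mathbf{x})+h_3(\mathfrak{w}(\mathbf{e})\mathbf{x})+C_2, \\ h(\mathbf{x}) & = h_1(\mathbf{e}-\mathbf{x})+h_2(\mathbf{e}-\mathbf{x})+h_3(\mathbf{x})+C_3,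 \\ k(\mathbf{x}) & = h_1(\mathbf{e}-\widetilde{\mathfrak{w}}(\mathbf{e})\mathbf{x})+h_2(\widetilde{\mathfrak{w}}(\mathbf{e})\mathbf{x})+C_4. \end{align*}
   Context: Let $\mathbb{E}$ be a simple Euclidean Jordan algebra (a Euclidean space with a bilinear commutative product satisfying $\mathbf{x}(\mathbf{x}^2\mathbf{y})=\mathbf{x}^2(\mathbf{x}\mathbf{y})$ and $\langle\mathbf{x},\mathbf{y}\mathbf{z}\rangle=\langle\mathbf{x}\mathbf{y},\mathbf{z}\rangle$, with neutral element $\mathbf{e}$, not a product of two Euclidean Jordan algebras of positive dimension), and let $\Omega$ be the interior of $\{\mathbf{x}^2\colon\mathbf{x}\in\mathbb{E}\}$, an irreducible symmetric cone. $G$ is the connected component containing the identity of the group of linear automorphisms of $\mathbb{E}$ preserving $\Omega$. A multiplication algorithm is a map $\mathfrak{w}\colon\Omega\to G$ with $\mathfrak{w}(\mathbf{x})\mathbf{e}=\mathbf{x}$ for all $\mathbf{x}\in\Omega$; the corresponding division algorithm is $\mathfrak{g}=\mathfrak{w}^{-1}$, i.e. $\mathfrak{g}(\mathbf{x})=(\mathfrak{w}(\mathbf{x}))^{-1}\in G$, so $\mathfrak{g}(\mathbf{x})\mathbf{x}=\mathbf{e}$. A function $f\colon\Omega\to\mathbb{R}$ is $\mathfrak{w}$-logarithmic if $f(\mathbf{x})+f(\mathfrak{w}(\mathbf{e})\mathbf{y})=f(\mathfrak{w}(\mathbf{x})\mathbf{y})$ for all $(\mathbf{x},\mathbf{y})\in\Omega^2$.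 Conditions on a multiplication algorithm $\mathfrak{w}$ (with $\mathfrak{g}=\mathfrak{w}^{-1}$): (A) $\mathfrak{w}(s\mathbf{x})=s\,\mathfrak{w}(\mathbf{x})$ for all $s>0$, $\mathbf{x}\in\Omega$; (B) $\lim_{\mathbf{x}\to\mathbf{e}}\mathfrak{w}(\mathbf{x})=\mathfrak{w}(\mathbf{e})$; (C) the mapping $\Omega\ni\mathbf{x}\mapsto\mathfrak{g}(\mathbf{x})\mathbf{e}\in\Omega$ is surjective. $\mathcal{D}=\{\mathbf{x}\in\Omega\colon\mathbf{e}-\mathbf{x}\in\Omega\}$ and $\mathcal{D}_0=\{(\mathbf{a},\mathbf{b})\in\mathcal{D}^2\colon\mathbf{a}+\mathbf{b}\in\mathcal{D}\}$. *)

theory Defs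
  imports "HOL-Analysis.Analysis"
begin

(* The carrier S is a linear subspace of the ambient Euclidean space, carrying the restricted
   inner product.  The algebra itself is the case S = UNIV; proper subspaces are needed as the
   factors of a direct product decomposition. *)
definition euclidean_jordan_algebra_on ::
    "'a::euclidean_space set \<Rightarrow> ('a \<Rightarrow> 'a \<Rightarrow> 'a) \<Rightarrow> 'a \<Rightarrow> bool" where
  "euclidean_jordan_algebra_on S jp e \<longleftrightarrow>
     subspace S \<and>
     (\<forall>x\<in>S. \<forall>y\<in>S. jp x y \<in> S) \<and>
     (\<forall>x\<in>S. \<forall>y\<in>S. \<forall>z\<in>S. jp (x + y) z = jp x z + jp y z) \<and>
     (\<forall>x\<in>S. \<forall>y\<in>S. \<forall>z\<in>S. jp x (y + z) = jp x y + jp x z) \<and>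
     (\<forall>c. \<forall>x\<in>S. \<forall>y\<in>S. jp (c *\<^sub>R x) y = c *\<^sub>R jp x y) \<and>
     (\<forall>c. \<forall>x\<in>S. \<forall>y\<in>S. jp x (c *\<^sub>R y) = c *\<^sub>R jp x y) \<and>
     (\<forall>x\<in>S. \<forall>y\<in>S. jp x y = jp y x) \<and>
     (\<forall>x\<in>S. \<forall>y\<in>S. jp x (jp (jp x x) y) = jp (jp x x) (jp x y)) \<and>
     (\<forall>x\<in>S. \<forall>y\<in>S. \<forall>z\<in>S. x \<bullet> jp y z = jp x y \<bullet> z) \<and>
     e \<in> S \<and> (\<forall>x\<in>S. jp e x = x \<and> jp x e = x)"

(* Being a product of two algebras is expressed internally: the factors are complementary
   subspaces annihilating each other.  They are then automatically orthogonal, since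
   u \<bullet> v = u \<bullet> jp e2 v = jp u e2 \<bullet> v = 0. *)
definition simple_euclidean_jordan_algebra ::
    "('a::euclidean_space \<Rightarrow> 'a \<Rightarrow> 'a) \<Rightarrow> 'a \<Rightarrow> bool" where
  "simple_euclidean_jordan_algebra jp e \<longleftrightarrow>
     euclidean_jordan_algebra_on UNIV jp e \<and>
     \<not> (\<exists>U V e1 e2.
          euclidean_jordan_algebra_on U jp e1 \<and> euclidean_jordan_algebra_on V jp e2 \<and>
          dim U > 0 \<and> dim V > 0 \<and>
          (\<forall>x. \<exists>u\<in>U. \<exists>v\<in>V. x = u + v) \<and> U \<inter> V = {0} \<and>
          (\<forall>u\<in>U. \<forall>v\<in>V. jp u v = 0))"

definition symmetric_cone :: "('a::euclidean_space \<Rightarrow> 'a \<Rightarrow> 'a) \<Rightarrow> 'a set" where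
  "symmetric_cone jp = interior {jp x x | x. True}"

definition cone_automorphisms ::
    "('a::euclidean_space \<Rightarrow> 'a \<Rightarrow> 'a) \<Rightarrow> ('a \<Rightarrow>\<^sub>L 'a) set" where
  "cone_automorphisms jp =
     {A. bij (blinfun_apply A) \<and> blinfun_apply A ` symmetric_cone jp = symmetric_cone jp}"

definition cone_group :: "('a::euclidean_space \<Rightarrow> 'a \<Rightarrow> 'a) \<Rightarrow> ('a \<Rightarrow>\<^sub>L 'a) set" where
  "cone_group jp = connected_component_set (cone_automorphisms jp) id_blinfun"

(* Maps with domain the cone (or the set dom_D below) are total functions whose values
   outside the domain are never used. *)
definition multiplication_algorithm ::
    "('a::euclidean_space \<Rightarrow> 'a \<Rightarrow> 'a) \<Rightarrow> 'a \<Rightarrow> ('a \<Rightarrow> 'a \<Rightarrow>\<^sub>L 'a) \<Rightarrow> bool" where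
  "multiplication_algorithm jp e w \<longleftrightarrow>
     (\<forall>x\<in>symmetric_cone jp. w x \<in> cone_group jp \<and> blinfun_apply (w x) e = x)"

(* Blinfun is meaningful here because the inverse of a bijective linear map of a Euclidean
   space is bounded linear. *)
definition division_algorithm ::
    "('a::euclidean_space \<Rightarrow> 'a \<Rightarrow>\<^sub>L 'a) \<Rightarrow> 'a \<Rightarrow> 'a \<Rightarrow>\<^sub>L 'a" where
  "division_algorithm w x = Blinfun (inv (blinfun_apply (w x)))"

lemma blinfun_apply_division_algorithm:
  assumes "bij (blinfun_apply (w x))"
  shows "blinfun_apply (division_algorithm w x) = inv (blinfun_apply (w x))"
proof -
  have "linear (blinfun_apply (w x))"
    by (simp add: blinfun.bounded_linear_right bounded_linear.linear)
  then have "linear (inv (blinfun_apply (w x)))"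
    using assms by (metis bij_def inj_linear_imp_inv_linear)
  then show ?thesis
    unfolding division_algorithm_def
    by (simp add: bounded_linear_Blinfun_apply linear_conv_bounded_linear)
qed

definition logarithmic ::
    "('a::euclidean_space \<Rightarrow> 'a \<Rightarrow> 'a) \<Rightarrow> 'a \<Rightarrow> ('a \<Rightarrow> 'a \<Rightarrow>\<^sub>L 'a) \<Rightarrow> ('a \<Rightarrow> real) \<Rightarrow> bool" where
  "logarithmic jp e w f \<longleftrightarrow>
     (\<forall>x\<in>symmetric_cone jp. \<forall>y\<in>symmetric_cone jp.
        f x + f (blinfun_apply (w e) y) = f (blinfun_apply (w x) y))"

definition homogeneous_alg ::
    "('a::euclidean_space \<Rightarrow> 'a \<Rightarrow> 'a) \<Rightarrow> ('a \<Rightarrow> 'a \<Rightarrow>\<^sub>L 'a) \<Rightarrow> bool" where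
  "homogeneous_alg jp w \<longleftrightarrow>
     (\<forall>s>0. \<forall>x\<in>symmetric_cone jp. w (s *\<^sub>R x) = s *\<^sub>R w x)"

definition continuous_at_unit_alg ::
    "('a::euclidean_space \<Rightarrow> 'a \<Rightarrow> 'a) \<Rightarrow> 'a \<Rightarrow> ('a \<Rightarrow> 'a \<Rightarrow>\<^sub>L 'a) \<Rightarrow> bool" where
  "continuous_at_unit_alg jp e w \<longleftrightarrow> (w \<longlongrightarrow> w e) (at e within symmetric_cone jp)"

definition surjective_division_alg ::
    "('a::euclidean_space \<Rightarrow> 'a \<Rightarrow> 'a) \<Rightarrow> 'a \<Rightarrow> ('a \<Rightarrow> 'a \<Rightarrow>\<^sub>L 'a) \<Rightarrow> bool" where
  "surjective_division_alg jp e w \<longleftrightarrow>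
     (\<lambda>x. blinfun_apply (division_algorithm w x) e) ` symmetric_cone jp = symmetric_cone jp"

definition dom_D :: "('a::euclidean_space \<Rightarrow> 'a \<Rightarrow> 'a) \<Rightarrow> 'a \<Rightarrow> 'a set" where
  "dom_D jp e = {x \<in> symmetric_cone jp. e - x \<in> symmetric_cone jp}"

definition dom_D0 :: "('a::euclidean_space \<Rightarrow> 'a \<Rightarrow> 'a) \<Rightarrow> 'a \<Rightarrow> ('a \<times> 'a) set" where
  "dom_D0 jp e = {(a, b). a \<in> dom_D jp e \<and> b \<in> dom_D jp e \<and> a + b \<in> dom_D jp e}"

end

theory Submission
  imports Defs
begin

text \<open>
The proof works with the cone \<open>\<Omega>\<close> through few properties: it is open, closed under sums and
positive multiples, contains \<open>e\<close>, and the order interval between \<open>0\<close> and \<open>e\<close> is bounded. They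
follow from the spectral theorem of the Jordan algebra: an element is a square exactly if
multiplication by it is positive semidefinite (\<open>squares_iff_mult_nonneg\<close>), so the squares form a
convex cone.

Replace \<open>w x\<close> by \<open>W x = w x \<circ> (w e)\<inverse>\<close>, which is the identity at \<open>x = e\<close>, and let \<open>V x\<close> be the inverse
of \<open>W x\<close>; with \<open>G = g \<circ> (w e)\<inverse>\<close> and \<open>K = k \<circ> (w' e)\<inverse>\<close> the equation becomes
\<open>f x + G (V (e - x) y) = h y + K (V' (e - y) x)\<close>.

First let \<open>y = r z\<close> with \<open>r\<close> tending to \<open>0\<close>. Because \<open>w'\<close> is continuous at \<open>e\<close>, the last term tends to
\<open>K x\<close>, so \<open>h (r z) - G (r V (e - x) z)\<close> tends to \<open>f x - K x\<close>, whatever \<open>z\<close> is. Comparing two values of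
\<open>x\<close> eliminates \<open>h\<close> and shows that \<open>G (r z) - G (r V x z)\<close> has a limit \<open>N x\<close> that does not depend on \<open>z\<close>.
This independence says that \<open>N\<close> is logarithmic, and it gives \<open>f x = K x + c + N (e - x)\<close>
(\<open>unmatched_pair_differs_by_log\<close>). Exchanging the roles of the variables treats \<open>h\<close> and \<open>G\<close>. The
two logarithmic functions found here are \<open>h3\<close> and \<open>h2\<close>.

After subtraction of these parts, \<open>A u = G (e - u) - h3 (e - u)\<close> and \<open>B u = K (e - u) - h2 (e - u)\<close>
satisfy a symmetric equation: \<open>B u + A (V u s) + d = A v + B (V' v s)\<close> with \<open>s = u + v - e\<close> and a
constant \<open>d\<close>, which turns out to be \<open>0\<close>. Two limits relate the behaviour of \<open>A\<close> at \<open>e\<close> to that of \<open>B\<close>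
at \<open>0\<close>. By the surjectivity of \<open>v \<mapsto> V' v e\<close>, one may choose \<open>u = r e\<close> and \<open>v = e - r q\<close> so that the
last argument is \<open>r z\<close> for a prescribed \<open>z\<close>; then \<open>q\<close> tends to \<open>e - z\<close>, and the equation shows that
\<open>B (r z) - B (r e)\<close> tends to \<open>A z - A0\<close>, even if \<open>z\<close> moves with \<open>r\<close> (\<open>B_near_zero_tendsto\<close>). Here
\<open>A0\<close> is the limit of \<open>A\<close> at \<open>e\<close> along any direction of the cone. Inserting \<open>u = r p\<close> and
\<open>v = e - r (p - x)\<close> and letting \<open>r\<close> tend to \<open>0\<close> yields \<open>A (V p x) - A0 = (A x - A0) - (A p - A0)\<close>, so
\<open>A - A0\<close> is the restriction of a function that is logarithmic for \<open>W\<close>. By symmetry \<open>B - B0\<close> is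
logarithmic for \<open>W'\<close>. The difference of the two functions satisfies
\<open>\<Delta> u + \<Delta> v = \<Delta> (u + v - e)\<close>; together with the rule for scalar multiples and continuity at \<open>e\<close> this
forces \<open>\<Delta> = 0\<close>, and the common function is \<open>h1\<close> (\<open>common_log\<close>).
\<close>

section \<open>Symmetric operators\<close>

text \<open>
A maximizer of the Rayleigh quotient on the unit sphere of the invariant subspace is an eigenvector:
the residual \<open>w\<close> lies in the subspace, and if it were nonzero, moving from \<open>v\<close> against \<open>w\<close> would
increase the quotient beyond its maximum.
\<close>

lemma symmetric_operator_eigenvector:
  fixes S :: "'a::euclidean_space \<Rightarrow> 'a"
  assumes "linear S" and sym: "\<And>x y. S x \<bullet> y = x \<bullet> S y"
    and V: "subspace V" "\<And>x. x \<in> V \<Longrightarrow> S x \<in> V" "V \<noteq> {0}"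
  obtains v l where "v \<in> V" "v \<noteq> 0" "S v = l *\<^sub>R v"
proof -
  interpret S: linear S by fact
  have contS: "continuous_on T S" for T
    using assms(1) linear_continuous_on linear_conv_bounded_linear by blast
  obtain v0 where v0: "v0 \<in> V" "v0 \<noteq> 0" using V(1,3) subspace_0 by blast
  have "compact (sphere 0 1 \<inter> V)"
    by (intro compact_Int_closed closed_subspace V compact_sphere)
  moreover have "v0 /\<^sub>R norm v0 \<in> sphere 0 1 \<inter> V"
    using v0 V(1) by (simp add: subspace_scale)
  moreover have "continuous_on (sphere 0 1 \<inter> V) (\<lambda>v. S v \<bullet> v)"
    by (intro continuous_intros contS)
  ultimately obtain v where v: "v \<in> sphere 0 1 \<inter> V"
    and max: "\<And>y. y \<in> sphere 0 1 \<inter> V \<Longrightarrow> S y \<bullet> y \<le> S v \<bullet> v"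
    using continuous_attains_sup[of "sphere 0 1 \<inter> V" "\<lambda>v. S v \<bullet> v"] by blast
  define l where "l = S v \<bullet> v"
  have vv: "v \<bullet> v = 1" "v \<in> V" "v \<noteq> 0" using v by (auto simp: dot_square_norm)
  have rayleigh: "S y \<bullet> y \<le> l * (y \<bullet> y)" if "y \<in> V" for y
  proof (cases "y = 0")
    case False
    have "y /\<^sub>R norm y \<in> sphere 0 1 \<inter> V"
      using that V(1) False by (simp add: subspace_scale)
    from max[OF this] show ?thesis
      using False by (simp add: l_def S.scale dot_square_norm field_simps power2_eq_square)
  qed (simp add: S.zero)
  define w where "w = l *\<^sub>R v - S v"
  have wV: "w \<in> V" unfolding w_def using V vv by (simp add: subspace_diff subspace_scale)
  have "w \<bullet> w = 0"
  proof (rule ccontr)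
    assume "w \<bullet> w \<noteq> 0"
    then have pos: "w \<bullet> w > 0" by simp
    define q where "q = l * (w \<bullet> w) - S w \<bullet> w"
    have q: "q \<ge> 0" using rayleigh[OF wV] by (simp add: q_def)
    have ineq: "0 \<le> 2 * t * (w \<bullet> w) + t\<^sup>2 * q" for t
    proof -
      have "v + t *\<^sub>R w \<in> V" using vv wV V by (simp add: subspace_add subspace_scale)
      from rayleigh[OF this]
      have "S v \<bullet> v + t * (S v \<bullet> w) + t * (S w \<bullet> v) + t\<^sup>2 * (S w \<bullet> w)
          \<le> l * (v \<bullet> v + 2 * t * (v \<bullet> w) + t\<^sup>2 * (w \<bullet> w))"
        by (simp add: S.add S.scale inner_add inner_commute power2_eq_square algebra_simps)
      moreover have "S w \<bullet> v = S v \<bullet> w" by (metis sym inner_commute)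
      ultimately have "0 \<le> 2 * t * (l * (v \<bullet> w) - S v \<bullet> w) + t\<^sup>2 * q"
        unfolding q_def by (simp add: l_def[symmetric] vv algebra_simps)
      then show ?thesis by (simp add: w_def inner_diff_left)
    qed
    \<comment> \<open>small enough that the linear term \<open>2 t (w \<bullet> w)\<close> dominates the quadratic one\<close>
    define t where "t = - (w \<bullet> w) / (q + w \<bullet> w)"
    have "t < 0" unfolding t_def using pos q by (intro divide_neg_pos add_nonneg_pos) simp_all
    have D: "q + w \<bullet> w > 0" using pos q by linarith
    have "(w \<bullet> w) * q / (q + w \<bullet> w) \<le> w \<bullet> w"
      by (simp add: pos_divide_le_eq[OF D] algebra_simps)
    then have tq: "t * q \<ge> - (w \<bullet> w)" by (simp add: t_def)
    have "2 * t * (w \<bullet> w) + t\<^sup>2 * q = t * (2 * (w \<bullet> w) + t * q)"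
      by (simp add: algebra_simps power2_eq_square)
    also have "\<dots> < 0" using \<open>t < 0\<close> tq pos by (intro mult_neg_pos) linarith+
    finally show False using ineq[of t] by simp
  qed
  then have "S v = l *\<^sub>R v" by (simp add: w_def)
  then show ?thesis using that vv by blast
qed

text \<open>
Split off one eigenvector and continue in its orthogonal complement, which symmetry keeps invariant.
The basis stays inside the given subspace; this matters below, where the subspace is spanned by the
powers of a single element.
\<close>

lemma symmetric_operator_eigenbasis:
  fixes S :: "'a::euclidean_space \<Rightarrow> 'a"
  assumes "linear S" and sym: "\<And>x y. S x \<bullet> y = x \<bullet> S y"
    and "subspace V" "\<And>x. x \<in> V \<Longrightarrow> S x \<in> V"
  shows "\<exists>B. finite B \<and> B \<subseteq> V \<and> 0 \<notin> B \<and> pairwise orthogonal B \<and>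
    (\<forall>b\<in>B. \<exists>l. S b = l *\<^sub>R b) \<and> span B = V"
  using assms(3,4)
proof (induction "dim V" arbitrary: V rule: less_induct)
  case less
  show ?case
  proof (cases "V = {0}")
    case True
    then show ?thesis by (intro exI[of _ "{}"]) auto
  next
    case False
    obtain v l where v: "v \<in> V" "v \<noteq> 0" "S v = l *\<^sub>R v"
      using symmetric_operator_eigenvector[OF assms(1,2) less.prems False] by blast
    define V' where "V' = V \<inter> {u. v \<bullet> u = 0}"
    have sub': "subspace V'"
      unfolding V'_def by (intro subspace_inter less.prems subspace_hyperplane)
    have inv': "S x \<in> V'" if "x \<in> V'" for x
      using that less.prems(2) v sym[of v x] by (auto simp: V'_def)
    have "v \<notin> V'" using v by (simp add: V'_def)
    then have "V' \<noteq> V" using v by blast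
    then have "dim V' < dim V"
      using sub' less.prems(1) dim_subset[of V' V] subspace_dim_equal[of V' V]
      by (fastforce simp: V'_def)
    from less.hyps[OF this sub' inv'] obtain B where B: "finite B" "B \<subseteq> V'" "0 \<notin> B"
      "pairwise orthogonal B" "\<forall>b\<in>B. \<exists>l. S b = l *\<^sub>R b" "span B = V'" by blast
    have "span (insert v B) = V"
    proof
      show "span (insert v B) \<subseteq> V"
        using B(2) v(1) less.prems(1) by (intro span_minimal) (auto simp: V'_def)
      show "V \<subseteq> span (insert v B)"
      proof
        fix u assume u: "u \<in> V"
        define c where "c = (v \<bullet> u) / (v \<bullet> v)"
        have "u - c *\<^sub>R v \<in> V'"
          using u v less.prems(1)
          by (simp add: V'_def c_def subspace_diff subspace_scale inner_diff_right)
        then show "u \<in> span (insert v B)"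
          using B(6) span_breakdown_eq by blast
      qed
    qed
    moreover have "pairwise orthogonal (insert v B)"
      using B(2,4) by (auto simp: pairwise_insert orthogonal_def V'_def inner_commute)
    ultimately show ?thesis
      using B v by (intro exI[of _ "insert v B"]) (auto simp: V'_def)
  qed
qed

section \<open>Squares in a Euclidean Jordan algebra\<close>

locale jordan_algebra =
  fixes jp :: "'a::euclidean_space \<Rightarrow> 'a \<Rightarrow> 'a" (infixl "\<bullet>\<^sub>J" 70) and e :: 'a
  assumes algebra: "euclidean_jordan_algebra_on UNIV jp e"
begin

lemma bilinear: "bilinear jp"
  using algebra unfolding euclidean_jordan_algebra_on_def bilinear_def
  by (auto intro!: linearI)

lemmas jp_simps = bilinear_ladd[OF bilinear] bilinear_radd[OF bilinear]
  bilinear_lmul[OF bilinear] bilinear_rmul[OF bilinear] bilinear_lsub[OF bilinear]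
  bilinear_rsub[OF bilinear] bilinear_lzero[OF bilinear] bilinear_rzero[OF bilinear]

lemma jp_commute: "x \<bullet>\<^sub>J y = y \<bullet>\<^sub>J x"
  using algebra unfolding euclidean_jordan_algebra_on_def by blast

lemma jordan_identity: "x \<bullet>\<^sub>J ((x \<bullet>\<^sub>J x) \<bullet>\<^sub>J y) = (x \<bullet>\<^sub>J x) \<bullet>\<^sub>J (x \<bullet>\<^sub>J y)"
  using algebra unfolding euclidean_jordan_algebra_on_def by blast

lemma associative_form: "x \<bullet> (y \<bullet>\<^sub>J z) = (x \<bullet>\<^sub>J y) \<bullet> z"
  using algebra unfolding euclidean_jordan_algebra_on_def by blast

lemma unit_left [simp]: "e \<bullet>\<^sub>J x = x" and unit_right [simp]: "x \<bullet>\<^sub>J e = x"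
  using algebra unfolding euclidean_jordan_algebra_on_def by blast+

lemma left_mult_symmetric: "(x \<bullet>\<^sub>J y) \<bullet> z = y \<bullet> (x \<bullet>\<^sub>J z)"
  by (metis associative_form jp_commute)

lemma linear_left_mult: "linear (jp x)"
  using bilinear unfolding bilinear_def by blast

lemma inner_square_unit: "(x \<bullet>\<^sub>J x) \<bullet> e = x \<bullet> x"
  by (metis left_mult_symmetric unit_right)

text \<open>
Comparing the Jordan identity at \<open>x + z\<close> and at \<open>x - z\<close> isolates the terms that are odd in \<open>z\<close>; the
cubic one vanishes by the identity for \<open>z\<close>. Read as an identity between operators acting on \<open>z\<close>, it
expresses multiplication by \<open>(x x) y\<close> through multiplications by \<open>x\<close>, \<open>y\<close>, \<open>x x\<close> and \<open>x y\<close>.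
\<close>

lemma jordan_identity_linearized:
  "(x \<bullet>\<^sub>J x \<bullet>\<^sub>J y) \<bullet>\<^sub>J z =
     (x \<bullet>\<^sub>J x) \<bullet>\<^sub>J (y \<bullet>\<^sub>J z) + 2 *\<^sub>R ((x \<bullet>\<^sub>J y) \<bullet>\<^sub>J (x \<bullet>\<^sub>J z)) - 2 *\<^sub>R (x \<bullet>\<^sub>J (y \<bullet>\<^sub>J (x \<bullet>\<^sub>J z)))"
proof -
  define J where "J u = u \<bullet>\<^sub>J ((u \<bullet>\<^sub>J u) \<bullet>\<^sub>J y) - (u \<bullet>\<^sub>J u) \<bullet>\<^sub>J (u \<bullet>\<^sub>J y)" for u
  have J: "J u = 0" for u by (simp add: J_def jordan_identity)
  define T where "T = z \<bullet>\<^sub>J ((x \<bullet>\<^sub>J x) \<bullet>\<^sub>J y) + 2 *\<^sub>R (x \<bullet>\<^sub>J ((x \<bullet>\<^sub>J z) \<bullet>\<^sub>J y))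
     - (x \<bullet>\<^sub>J x) \<bullet>\<^sub>J (z \<bullet>\<^sub>J y) - 2 *\<^sub>R ((x \<bullet>\<^sub>J z) \<bullet>\<^sub>J (x \<bullet>\<^sub>J y))"
  have "J (x + z) - J (x - z) = 2 *\<^sub>R T + 2 *\<^sub>R J z"
    unfolding J_def T_def
    by (simp add: jp_simps jp_commute[of z x] algebra_simps scaleR_2)
  then have "T = 0" by (simp add: J)
  then show ?thesis
    unfolding T_def
    by (simp add: algebra_simps jp_commute[of z] jp_commute[of "x \<bullet>\<^sub>J z"])
qed

definition jpow :: "'a \<Rightarrow> nat \<Rightarrow> 'a" where "jpow x n = ((\<bullet>\<^sub>J) x ^^ n) e"

lemma jpow_0 [simp]: "jpow x 0 = e" and jpow_Suc: "jpow x (Suc n) = x \<bullet>\<^sub>J jpow x n"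
  by (simp_all add: jpow_def)

lemma square_times_jpow: "(x \<bullet>\<^sub>J x) \<bullet>\<^sub>J jpow x n = jpow x (Suc (Suc n))"
  by (induction n) (simp_all add: jpow_Suc jordan_identity[symmetric])

text \<open>
With \<open>y\<close> a power of \<open>x\<close>, the linearized identity is a recursion that builds multiplication by \<open>x\<close> to
the power \<open>n + 2\<close> from operators that commute with multiplication by \<open>x\<close>. Power associativity follows
at once.
\<close>

lemma jpow_mult_commutes: "jpow x n \<bullet>\<^sub>J (x \<bullet>\<^sub>J z) = x \<bullet>\<^sub>J (jpow x n \<bullet>\<^sub>J z)"
proof (induction n arbitrary: z rule: induct_nat_012)
  case (ge2 n)
  have "jpow x (Suc (Suc n)) \<bullet>\<^sub>J u = (x \<bullet>\<^sub>J x) \<bullet>\<^sub>J (jpow x n \<bullet>\<^sub>J u)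
      + 2 *\<^sub>R (jpow x (Suc n) \<bullet>\<^sub>J (x \<bullet>\<^sub>J u)) - 2 *\<^sub>R (x \<bullet>\<^sub>J (jpow x n \<bullet>\<^sub>J (x \<bullet>\<^sub>J u)))" for u
    using jordan_identity_linearized[of x "jpow x n" u]
    by (simp add: square_times_jpow jpow_Suc[symmetric])
  then show ?case by (simp add: ge2 jp_simps jordan_identity)
qed (simp_all add: jpow_Suc)

lemma jpow_add: "jpow x m \<bullet>\<^sub>J jpow x n = jpow x (m + n)"
  by (induction n) (simp_all add: jpow_Suc jpow_mult_commutes)

text \<open>
On the span of the powers of \<open>x\<close>, multiplication by a power of \<open>x\<close> is the corresponding iterate of
multiplication by \<open>x\<close>, so that it acts on an eigenvector of the latter as a scalar.
\<close>

lemma jpow_times_eigenvector: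
  assumes v: "v \<in> span (range (jpow x))" and "x \<bullet>\<^sub>J v = l *\<^sub>R v"
  shows "jpow x n \<bullet>\<^sub>J v = l ^ n *\<^sub>R v"
proof (induction n)
  case (Suc n)
  have "jpow x (Suc n) \<bullet>\<^sub>J u = x \<bullet>\<^sub>J (jpow x n \<bullet>\<^sub>J u)" if "u \<in> span (range (jpow x))" for u
    using that
  proof (induction rule: span_induct_alt)
    case (step c w y)
    then obtain m where "w = jpow x m" by blast
    then have "jpow x (Suc n) \<bullet>\<^sub>J w = jpow x (Suc (n + m))"
      by (metis add_Suc jpow_add)
    then have "jpow x (Suc n) \<bullet>\<^sub>J w = x \<bullet>\<^sub>J (jpow x n \<bullet>\<^sub>J w)"
      using \<open>w = jpow x m\<close> by (simp add: jpow_add jpow_Suc[of x "n + m"])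
    with step show ?case by (simp add: jp_simps)
  qed (simp add: jp_simps)
  then show ?case using Suc v assms(2) by (simp add: jp_simps)
qed simp

lemma span_jpow_times_eigenvector:
  assumes "v \<in> span (range (jpow x))" "x \<bullet>\<^sub>J v = l *\<^sub>R v" "u \<in> span (range (jpow x))"
  shows "\<exists>m. u \<bullet>\<^sub>J v = m *\<^sub>R v"
  using assms(3)
proof (induction rule: span_induct_alt)
  case base
  show ?case by (intro exI[of _ 0]) (simp add: jp_simps)
next
  case (step c w y)
  then obtain n m where "w = jpow x n" "y \<bullet>\<^sub>J v = m *\<^sub>R v" by auto
  then have "(c *\<^sub>R w + y) \<bullet>\<^sub>J v = (c * l ^ n + m) *\<^sub>R v"
    using jpow_times_eigenvector[OF assms(1,2)] by (simp add: jp_simps algebra_simps)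
  then show ?case by blast
qed

text \<open>
Take an orthogonal basis, within the span of the powers of \<open>x\<close>, of eigenvectors of multiplication by
\<open>x\<close>. Every element of this span acts on each basis vector as a scalar. Hence the product of two distinct
basis vectors is a multiple of both and therefore zero, and the square of a basis vector is a nonzero
multiple of it; rescaling turns the basis into orthogonal idempotents.
\<close>

theorem spectral_decomposition:
  obtains C and l :: "'a \<Rightarrow> real" where "finite C" "\<And>c. c \<in> C \<Longrightarrow> c \<noteq> 0" "\<And>c. c \<in> C \<Longrightarrow> c \<bullet>\<^sub>J c = c"
    "\<And>c d. c \<in> C \<Longrightarrow> d \<in> C \<Longrightarrow> c \<noteq> d \<Longrightarrow> c \<bullet>\<^sub>J d = 0" "x = (\<Sum>c\<in>C. l c *\<^sub>R c)"
proof -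
  let ?V = "span (range (jpow x))"
  have inv: "x \<bullet>\<^sub>J u \<in> ?V" if "u \<in> ?V" for u
    using that
  proof (induction rule: span_induct_alt)
    case (step c w y)
    then obtain n where "w = jpow x n" by blast
    then have "x \<bullet>\<^sub>J w = jpow x (Suc n)" by (simp add: jpow_Suc)
    then have "x \<bullet>\<^sub>J w \<in> ?V" by (simp add: span_base)
    with step show ?case by (simp add: jp_simps span_add span_scale)
  qed (simp add: jp_simps span_0)
  have "\<exists>B. finite B \<and> B \<subseteq> ?V \<and> 0 \<notin> B \<and> pairwise orthogonal B \<and>
      (\<forall>b\<in>B. \<exists>l. x \<bullet>\<^sub>J b = l *\<^sub>R b) \<and> span B = ?V"
    by (rule symmetric_operator_eigenbasis[OF linear_left_mult left_mult_symmetric])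
      (simp_all add: inv)
  then obtain B where B: "finite B" "B \<subseteq> ?V" "0 \<notin> B" "pairwise orthogonal B"
      "\<forall>b\<in>B. \<exists>l. x \<bullet>\<^sub>J b = l *\<^sub>R b" "span B = ?V"
    by (elim exE conjE)
  have prod: "\<exists>m. u \<bullet>\<^sub>J b = m *\<^sub>R b" if u: "u \<in> ?V" and b: "b \<in> B" for u b
  proof -
    obtain l where "x \<bullet>\<^sub>J b = l *\<^sub>R b" using B(5) b by blast
    then show ?thesis using span_jpow_times_eigenvector[of b x l u] B(2) u b by auto
  qed
  have orth: "b \<bullet>\<^sub>J b' = 0" if b: "b \<in> B" "b' \<in> B" "b \<noteq> b'" for b b'
  proof -
    obtain m where m: "b \<bullet>\<^sub>J b' = m *\<^sub>R b'" using prod[of b b'] B b by blast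
    obtain m' where m': "b' \<bullet>\<^sub>J b = m' *\<^sub>R b" using prod[of b' b] B b by blast
    have "b \<bullet> b' = 0" using B(4) b by (auto simp: pairwise_def orthogonal_def)
    then have "m * (b' \<bullet> b') = 0"
      using m m' by (metis inner_commute inner_scaleR_left jp_commute mult_zero_right)
    then show ?thesis using m B(3) b by auto
  qed
  obtain m where m: "b \<bullet>\<^sub>J b = m b *\<^sub>R b" if "b \<in> B" for b
    using prod B(2) by (meson subsetD)
  \<comment> \<open>a square has inner product \<open>b \<bullet> b\<close> with the unit, so it cannot vanish\<close>
  have m0: "m b \<noteq> 0" if "b \<in> B" for b
    using that m[OF that] inner_square_unit[of b] B(3) by auto
  define c where "c b = b /\<^sub>R m b" for b
  have c: "c b \<noteq> 0" "c b \<bullet>\<^sub>J c b = c b" if "b \<in> B" for b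
    using that m0 B(3) m by (auto simp: c_def jp_simps)
  have cc: "c b \<bullet>\<^sub>J c b' = 0" if "b \<in> B" "b' \<in> B" "b \<noteq> b'" for b b'
    using that orth by (simp add: c_def jp_simps)
  have inj: "inj_on c B" using c cc by (metis inj_onI)
  have "x = jpow x (Suc 0)" by (simp add: jpow_Suc)
  then have "x \<in> ?V" by (metis rangeI span_base)
  then have "x \<in> span B" by (simp add: B)
  then obtain a where "x = (\<Sum>b\<in>B. a b *\<^sub>R b)"
    using span_finite[OF B(1)] by auto
  also have "\<dots> = (\<Sum>b\<in>B. (a b * m b) *\<^sub>R c b)"
    by (intro sum.cong) (auto simp: c_def m0)
  also have "\<dots> = (\<Sum>b\<in>B. (a (inv_into B c (c b)) * m (inv_into B c (c b))) *\<^sub>R c b)"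
    by (intro sum.cong) (auto simp: inj)
  also have "\<dots> = (\<Sum>d\<in>c ` B. (a (inv_into B c d) * m (inv_into B c d)) *\<^sub>R d)"
    by (simp add: sum.reindex[OF inj])
  finally show ?thesis
    using B(1) c cc by (intro that[of "c ` B"]) auto
qed

lemma square_of_spectral_sum:
  assumes "finite C" "\<And>c. c \<in> C \<Longrightarrow> c \<bullet>\<^sub>J c = c"
    "\<And>c d. c \<in> C \<Longrightarrow> d \<in> C \<Longrightarrow> c \<noteq> d \<Longrightarrow> c \<bullet>\<^sub>J d = 0"
  shows "(\<Sum>c\<in>C. l c *\<^sub>R c) \<bullet>\<^sub>J (\<Sum>c\<in>C. l c *\<^sub>R c) = (\<Sum>c\<in>C. (l c)\<^sup>2 *\<^sub>R c)"
proof -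
  have "(\<Sum>c\<in>C. l c *\<^sub>R c) \<bullet>\<^sub>J (\<Sum>c\<in>C. l c *\<^sub>R c) = (\<Sum>c\<in>C. \<Sum>d\<in>C. l c *\<^sub>R l d *\<^sub>R (c \<bullet>\<^sub>J d))"
    by (simp add: bilinear_sum[OF bilinear] assms(1) sum.cartesian_product jp_simps mult.commute)
  also have "\<dots> = (\<Sum>c\<in>C. \<Sum>d\<in>C. if d = c then (l c)\<^sup>2 *\<^sub>R c else 0)"
    using assms(2,3) by (intro sum.cong) (auto simp: power2_eq_square)
  finally show ?thesis by (simp add: assms(1))
qed

text \<open>
Multiplication \<open>L\<close> by an idempotent satisfies \<open>2 L\<^sup>3 - 3 L\<^sup>2 + L = 0\<close>, so its eigenvalues are among
\<open>0\<close>, \<open>1/2\<close> and \<open>1\<close>. On these three numbers \<open>t = t\<^sup>2 + 4 (t - t\<^sup>2)\<^sup>2\<close>, hence \<open>L = L\<^sup>2 + 4 (L - L\<^sup>2)\<^sup>2\<close>, which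
is visibly positive semidefinite because \<open>L\<close> is symmetric.
\<close>

lemma idempotent_mult_nonneg:
  assumes c: "c \<bullet>\<^sub>J c = c"
  shows "0 \<le> (c \<bullet>\<^sub>J z) \<bullet> z"
proof -
  define L where "L = (\<bullet>\<^sub>J) c"
  have cubic: "L u = 3 *\<^sub>R L (L u) - 2 *\<^sub>R L (L (L u))" for u
  proof -
    have "3 *\<^sub>R L (L u) = L (L u) + 2 *\<^sub>R L (L u)"
      using scaleR_left_distrib[of 1 2 "L (L u)"] by simp
    then show ?thesis using jordan_identity_linearized[of c c u] by (simp add: c L_def)
  qed
  have sym: "L u \<bullet> v = u \<bullet> L v" for u v by (simp add: L_def left_mult_symmetric)
  \<comment> \<open>the claim is \<open>a1 = a2 + 4 (a2 - 2 a3 + a4)\<close>, tested on \<open>z\<close>\<close>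
  define a1 a2 a3 a4 where "a1 = L z \<bullet> z" and "a2 = L (L z) \<bullet> z" and "a3 = L (L (L z)) \<bullet> z"
    and "a4 = L (L (L (L z))) \<bullet> z"
  have "a1 = 3 * a2 - 2 * a3"
    unfolding a1_def a2_def a3_def by (subst cubic) (simp add: inner_diff_left)
  moreover have "a2 = 3 * a3 - 2 * a4"
    unfolding a2_def a3_def a4_def by (subst cubic) (simp add: inner_diff_left)
  moreover have "L z \<bullet> L z = a2" "L z \<bullet> L (L z) = a3" "L (L z) \<bullet> L z = a3" "L (L z) \<bullet> L (L z) = a4"
    unfolding a2_def a3_def a4_def by (simp_all add: sym)
  then have "(L z - L (L z)) \<bullet> (L z - L (L z)) = a2 - 2 * a3 + a4" "L z \<bullet> L z = a2"
    by (simp_all add: inner_diff_left inner_diff_right)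
  then have "a2 \<ge> 0" "a2 - 2 * a3 + a4 \<ge> 0" by (metis inner_ge_zero)+
  ultimately have "a1 \<ge> 0" by simp
  then show ?thesis by (simp add: a1_def L_def)
qed

text \<open>
In a spectral decomposition the coefficients of a square are squares, and idempotents act positively.
Conversely, testing positivity of multiplication by \<open>x\<close> on its own idempotents shows that the spectral
coefficients are nonnegative, so that they have square roots.
\<close>

theorem squares_iff_mult_nonneg: "(\<exists>y. x = y \<bullet>\<^sub>J y) \<longleftrightarrow> (\<forall>z. 0 \<le> (x \<bullet>\<^sub>J z) \<bullet> z)"
proof
  assume "\<exists>y. x = y \<bullet>\<^sub>J y"
  then obtain y where x: "x = y \<bullet>\<^sub>J y" by blast
  obtain C l where C: "finite C" "\<And>c. c \<in> C \<Longrightarrow> c \<noteq> 0" "\<And>c. c \<in> C \<Longrightarrow> c \<bullet>\<^sub>J c = c"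
    "\<And>c d. c \<in> C \<Longrightarrow> d \<in> C \<Longrightarrow> c \<noteq> d \<Longrightarrow> c \<bullet>\<^sub>J d = 0" "y = (\<Sum>c\<in>C. l c *\<^sub>R c)"
    using spectral_decomposition[of y] by blast
  have "x = (\<Sum>c\<in>C. (l c)\<^sup>2 *\<^sub>R c)" unfolding x C(5) by (rule square_of_spectral_sum[OF C(1,3,4)])
  then have "(x \<bullet>\<^sub>J z) \<bullet> z = (\<Sum>c\<in>C. (l c)\<^sup>2 * ((c \<bullet>\<^sub>J z) \<bullet> z))" for z
    by (simp add: linear_sum[OF linear_left_mult] jp_commute[of _ z] jp_simps inner_sum_left)
  then show "\<forall>z. 0 \<le> (x \<bullet>\<^sub>J z) \<bullet> z"
    using C(3) idempotent_mult_nonneg by (simp add: sum_nonneg)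
next
  assume nonneg: "\<forall>z. 0 \<le> (x \<bullet>\<^sub>J z) \<bullet> z"
  obtain C l where C: "finite C" "\<And>c. c \<in> C \<Longrightarrow> c \<noteq> 0" "\<And>c. c \<in> C \<Longrightarrow> c \<bullet>\<^sub>J c = c"
    "\<And>c d. c \<in> C \<Longrightarrow> d \<in> C \<Longrightarrow> c \<noteq> d \<Longrightarrow> c \<bullet>\<^sub>J d = 0" "x = (\<Sum>c\<in>C. l c *\<^sub>R c)"
    using spectral_decomposition[of x] by blast
  have l: "l c \<ge> 0" if c: "c \<in> C" for c
  proof -
    have "x \<bullet>\<^sub>J c = (\<Sum>d\<in>C. l d *\<^sub>R (c \<bullet>\<^sub>J d))"
      unfolding C(5) by (subst jp_commute) (simp add: linear_sum[OF linear_left_mult] jp_simps)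
    also have "\<dots> = (\<Sum>d\<in>C. if d = c then l c *\<^sub>R c else 0)"
      using C(3,4) c by (intro sum.cong) auto
    also have "\<dots> = l c *\<^sub>R c" using C(1) c by simp
    finally have "0 \<le> l c * (c \<bullet> c)" using nonneg by (metis inner_scaleR_left)
    moreover have "c \<bullet> c > 0" using C(2) c by simp
    ultimately show ?thesis by (simp add: zero_le_mult_iff)
  qed
  have "x = (\<Sum>c\<in>C. (sqrt (l c))\<^sup>2 *\<^sub>R c)"
    unfolding C(5) by (intro sum.cong) (auto simp: l)
  also have "\<dots> = (\<Sum>c\<in>C. sqrt (l c) *\<^sub>R c) \<bullet>\<^sub>J (\<Sum>c\<in>C. sqrt (l c) *\<^sub>R c)"
    by (rule square_of_spectral_sum[OF C(1,3,4), symmetric])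
  finally show "\<exists>y. x = y \<bullet>\<^sub>J y" by blast
qed

end

section \<open>Open convex cones\<close>

lemma tendsto_at_right_0_scale:
  fixes F :: "real \<Rightarrow> 'b::topological_space"
  assumes "(F \<longlongrightarrow> l) (at_right 0)" "c > 0"
  shows "((\<lambda>r. F (c * r)) \<longlongrightarrow> l) (at_right 0)"
proof (rule filterlim_compose[OF assms(1)])
  have "((\<lambda>r. c * r) \<longlongrightarrow> 0) (at_right 0)" by (auto intro!: tendsto_eq_intros)
  moreover have "\<forall>\<^sub>F r in at_right 0. c * r \<in> {0<..} \<and> c * r \<noteq> 0"
    using eventually_at_right_less[of "0::real"] by eventually_elim (use assms(2) in auto)
  ultimately show "filterlim (\<lambda>r. c * r) (at_right 0) (at_right 0)"
    by (simp add: filterlim_at)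
qed

text \<open>
The features of a symmetric cone on which the functional equation depends. Boundedness of the order
interval provides compactness; it expresses that the closure of the cone contains no line.
\<close>

locale open_cone =
  fixes \<Omega> :: "'a::euclidean_space set" and e :: 'a
  assumes cone_open: "open \<Omega>"
    and cone_add: "x \<in> \<Omega> \<Longrightarrow> y \<in> \<Omega> \<Longrightarrow> x + y \<in> \<Omega>"
    and cone_scale: "0 < s \<Longrightarrow> x \<in> \<Omega> \<Longrightarrow> s *\<^sub>R x \<in> \<Omega>"
    and unit_in_cone: "e \<in> \<Omega>"
    and bounded_interval: "bounded {x \<in> \<Omega>. e - x \<in> \<Omega>}"
begin

definition D where "D = {x \<in> \<Omega>. e - x \<in> \<Omega>}"

lemma D_iff: "x \<in> D \<longleftrightarrow> x \<in> \<Omega> \<and> e - x \<in> \<Omega>"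
  by (simp add: D_def)

lemma bounded_D: "bounded D"
  using bounded_interval by (simp add: D_def)

lemma cone_add_scaled_unit: "x \<in> \<Omega> \<Longrightarrow> 0 \<le> s \<Longrightarrow> x + s *\<^sub>R e \<in> \<Omega>"
  using cone_add[of x "s *\<^sub>R e"] cone_scale[of s e] unit_in_cone by (cases "s = 0") auto

lemma scaled_unit_in_D: "0 < s \<Longrightarrow> s < 1 \<Longrightarrow> s *\<^sub>R e \<in> D"
  using cone_scale[of s e] cone_scale[of "1 - s" e] unit_in_cone
  by (simp add: D_iff algebra_simps)

lemma scaled_D: "x \<in> D \<Longrightarrow> 0 < s \<Longrightarrow> s \<le> 1 \<Longrightarrow> s *\<^sub>R x \<in> D"
  using cone_scale[of s x] cone_add_scaled_unit[of "s *\<^sub>R (e - x)" "1 - s"] cone_scale[of s "e - x"]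
  by (simp add: D_iff algebra_simps)

lemma D_complement: "x \<in> D \<Longrightarrow> e - x \<in> D"
  by (simp add: D_iff)

lemma open_D: "open D"
proof -
  have "D = \<Omega> \<inter> (\<lambda>x. e - x) -` \<Omega>" by (auto simp: D_iff)
  moreover have "open ((\<lambda>x. e - x) -` \<Omega>)"
    by (intro open_vimage cone_open continuous_intros)
  ultimately show ?thesis by (simp add: open_Int cone_open)
qed

text \<open>
Approximate \<open>y\<close> by points of the cone; the error can be absorbed into \<open>x\<close>, which is an interior point.
This places order intervals defined through the closure, which are compact, inside \<open>D\<close>.
\<close>

lemma closure_cone_add: "x \<in> \<Omega> \<Longrightarrow> y \<in> closure \<Omega> \<Longrightarrow> x + y \<in> \<Omega>"
proof -
  assume x: "x \<in> \<Omega>" and "y \<in> closure \<Omega>"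
  then obtain Y where Y: "\<And>n. Y n \<in> \<Omega>" "Y \<longlonglongrightarrow> y" unfolding closure_sequential by blast
  have "(\<lambda>n. x + y - Y n) \<longlonglongrightarrow> x + y - y" by (intro tendsto_intros Y)
  then have "\<forall>\<^sub>F n in sequentially. x + y - Y n \<in> \<Omega>"
    using topological_tendstoD[OF _ cone_open] x by auto
  then obtain n where "x + y - Y n \<in> \<Omega>"
    using eventually_happens'[OF sequentially_bot] by blast
  from cone_add[OF this Y(1)[of n]] show ?thesis by simp
qed

lemma eventually_minus_scaled: "x \<in> \<Omega> \<Longrightarrow> \<forall>\<^sub>F s in at_right 0. x - s *\<^sub>R y \<in> \<Omega>"
proof -
  assume x: "x \<in> \<Omega>"
  have "((\<lambda>s. x - s *\<^sub>R y) \<longlongrightarrow> x - 0 *\<^sub>R y) (at_right 0)" by (intro tendsto_intros)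
  then show ?thesis using topological_tendstoD[OF _ cone_open] x by auto
qed

lemma eventually_scaled_in_D: "x \<in> \<Omega> \<Longrightarrow> \<forall>\<^sub>F s in at_right 0. s *\<^sub>R x \<in> D"
  using eventually_minus_scaled[OF unit_in_cone, of x] eventually_at_right_less[of "0::real"]
  by eventually_elim (simp add: D_iff cone_scale)

lemma eventually_at_right_less_1: "\<forall>\<^sub>F s::real in at_right 0. s < 1"
  by (rule eventually_at_right_real[THEN eventually_mono, of 0 1]) auto

lemma obtain_scale:
  assumes "x \<in> \<Omega>"
  obtains t :: real where "0 < t" "t < 1" "t *\<^sub>R x \<in> D"
proof -
  have "\<forall>\<^sub>F t in at_right (0::real). 0 < t \<and> t < 1 \<and> t *\<^sub>R x \<in> D"
    using eventually_scaled_in_D[OF assms] eventually_at_right_less[of "0::real"] eventually_at_right_less_1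
    by eventually_elim auto
  then show ?thesis using that eventually_happens'[OF trivial_limit_at_right_real] by blast
qed

text \<open>
Every point of the cone has a neighbourhood inside an order interval from \<open>s e\<close> to \<open>(1 / s) e\<close>; the
uniform estimates below hold on such intervals.
\<close>

lemma eventually_between:
  assumes "z \<in> \<Omega>"
  obtains s :: real where "0 < s" "s < 1" "\<forall>\<^sub>F x in nhds z. x - s *\<^sub>R e \<in> \<Omega> \<and> e - s *\<^sub>R x \<in> \<Omega>"
proof -
  have "\<forall>\<^sub>F t in at_right (0::real). 0 < t \<and> t < 1 \<and> z - t *\<^sub>R e \<in> \<Omega> \<and> e - t *\<^sub>R z \<in> \<Omega>"
    using eventually_minus_scaled[OF assms, of e] eventually_minus_scaled[OF unit_in_cone, of z]
      eventually_at_right_less[of "0::real"] eventually_at_right_less_1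
    by eventually_elim auto
  then obtain s where s: "0 < s" "s < 1" "z - s *\<^sub>R e \<in> \<Omega>" "e - s *\<^sub>R z \<in> \<Omega>"
    using eventually_happens'[OF trivial_limit_at_right_real] by blast
  have "((\<lambda>x. x - s *\<^sub>R e) \<longlongrightarrow> z - s *\<^sub>R e) (nhds z)" "((\<lambda>x. e - s *\<^sub>R x) \<longlongrightarrow> e - s *\<^sub>R z) (nhds z)"
    by (intro tendsto_intros filterlim_ident)+
  from this[THEN topological_tendstoD, OF cone_open] s
  have "\<forall>\<^sub>F x in nhds z. x - s *\<^sub>R e \<in> \<Omega> \<and> e - s *\<^sub>R x \<in> \<Omega>"
    by (simp add: eventually_conj_iff)
  then show ?thesis using that s by blast
qed

lemma tendsto_D:
  assumes "continuous_on D f" "(x \<longlongrightarrow> x0) F" "x0 \<in> D"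
  shows "((\<lambda>n. f (x n)) \<longlongrightarrow> f x0) F"
proof -
  have "isCont f x0" using assms open_D by (simp add: continuous_on_eq_continuous_at)
  then show ?thesis using assms(2) by (rule isCont_tendsto_compose)
qed

lemma eventually_in_D: "(x \<longlongrightarrow> x0) F \<Longrightarrow> x0 \<in> D \<Longrightarrow> \<forall>\<^sub>F n in F. x n \<in> D"
  using open_D topological_tendstoD by blast

end

section \<open>Multiplication algorithms that are the identity at the unit\<close>

text \<open>
\<open>W\<close> is a multiplication algorithm with the identity at \<open>e\<close>, and \<open>V\<close> is its division algorithm. The
continuity condition at \<open>e\<close> is convergence in operator norm, spelled out for plain functions.
\<close>

locale normalized_algorithm = open_cone \<Omega> e for \<Omega> :: "'a::euclidean_space set" and e +
  fixes W V :: "'a \<Rightarrow> 'a \<Rightarrow> 'a"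
  assumes linear_W: "x \<in> \<Omega> \<Longrightarrow> linear (W x)"
    and W_V: "x \<in> \<Omega> \<Longrightarrow> W x (V x y) = y"
    and V_W: "x \<in> \<Omega> \<Longrightarrow> V x (W x y) = y"
    and W_in_cone_iff: "x \<in> \<Omega> \<Longrightarrow> W x y \<in> \<Omega> \<longleftrightarrow> y \<in> \<Omega>"
    and W_e: "x \<in> \<Omega> \<Longrightarrow> W x e = x"
    and W_scale: "x \<in> \<Omega> \<Longrightarrow> 0 < s \<Longrightarrow> W (s *\<^sub>R x) y = s *\<^sub>R W x y"
    and W_unit: "W e y = y"
    and W_near_unit: "0 < r \<Longrightarrow> \<exists>d>0. \<forall>x\<in>\<Omega>. dist x e < d \<longrightarrow> (\<forall>y. norm (W x y - y) \<le> r * norm y)"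
    and V_onto: "z \<in> \<Omega> \<Longrightarrow> \<exists>x\<in>\<Omega>. V x e = z"
begin

lemma linear_V: "x \<in> \<Omega> \<Longrightarrow> linear (V x)"
proof (rule linearI)
  fix y z c assume x: "x \<in> \<Omega>"
  show "V x (y + z) = V x y + V x z"
    using V_W[OF x, of "V x y + V x z"] by (simp add: linear_add[OF linear_W[OF x]] W_V[OF x])
  show "V x (c *\<^sub>R y) = c *\<^sub>R V x y"
    using V_W[OF x, of "c *\<^sub>R V x y"] by (simp add: linear_scale[OF linear_W[OF x]] W_V[OF x])
qed

lemma V_in_cone_iff: "x \<in> \<Omega> \<Longrightarrow> V x y \<in> \<Omega> \<longleftrightarrow> y \<in> \<Omega>"
  using W_in_cone_iff[of x "V x y"] by (simp add: W_V)

lemma V_self: "x \<in> \<Omega> \<Longrightarrow> V x x = e"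
  using V_W[of x e] by (simp add: W_e)

lemma V_scale: "x \<in> \<Omega> \<Longrightarrow> 0 < s \<Longrightarrow> V (s *\<^sub>R x) y = (1 / s) *\<^sub>R V x y"
proof -
  assume a: "x \<in> \<Omega>" "0 < s"
  have "W (s *\<^sub>R x) ((1 / s) *\<^sub>R V x y) = y"
    using a by (simp add: W_scale linear_scale[OF linear_W] W_V)
  then show ?thesis
    using V_W[of "s *\<^sub>R x" "(1 / s) *\<^sub>R V x y"] a cone_scale[of s x] by simp
qed

lemma V_unit: "V e y = y"
  using V_W[OF unit_in_cone, of y] by (simp add: W_unit)

lemma V_scaled_unit: "0 < s \<Longrightarrow> V (s *\<^sub>R e) y = (1 / s) *\<^sub>R y"
  by (simp add: V_scale unit_in_cone V_unit)

lemma W_scaled_unit: "0 < s \<Longrightarrow> W (s *\<^sub>R e) y = s *\<^sub>R y"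
  by (simp add: W_scale unit_in_cone W_unit)

lemmas V_add = linear_add[OF linear_V]
lemmas V_diff = linear_diff[OF linear_V]
lemmas V_scaleR = linear_scale[OF linear_V]
lemmas W_diff = linear_diff[OF linear_W]
lemmas W_scaleR = linear_scale[OF linear_W]

text \<open>
Once \<open>W x\<close> is within \<open>1/2\<close> of the identity, its inverse has norm at most \<open>2\<close>, so that \<open>V x\<close> is close to
the identity too.
\<close>

lemma V_near_unit:
  assumes "0 < r"
  shows "\<exists>d>0. \<forall>x\<in>\<Omega>. dist x e < d \<longrightarrow> (\<forall>y. norm (V x y - y) \<le> r * norm y)"
proof -
  have "0 < min (1/2) (r/2)" using assms by simp
  from W_near_unit[OF this] obtain d where d: "d > 0"
    "\<And>x y. x \<in> \<Omega> \<Longrightarrow> dist x e < d \<Longrightarrow> norm (W x y - y) \<le> min (1/2) (r/2) * norm y" by blast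
  have "norm (V x y - y) \<le> r * norm y" if x: "x \<in> \<Omega>" "dist x e < d" for x y
  proof -
    have b: "norm (W x z - z) \<le> 1/2 * norm z" "norm (W x z - z) \<le> r/2 * norm z" for z
    proof -
      have "min (1/2) (r/2) * norm z \<le> 1/2 * norm z" "min (1/2) (r/2) * norm z \<le> r/2 * norm z"
        by (intro mult_right_mono; simp)+
      then show "norm (W x z - z) \<le> 1/2 * norm z" "norm (W x z - z) \<le> r/2 * norm z"
        using d(2)[OF x, of z] by linarith+
    qed
    have "norm (V x z) \<le> 2 * norm z" for z
      using b(1)[of "V x z"] norm_triangle_ineq2[of "V x z" z] x by (simp add: W_V norm_minus_commute)
    then have "norm (V x (y - W x y)) \<le> 2 * norm (y - W x y)" .
    then show ?thesis using b(2)[of y] x by (simp add: V_diff V_W norm_minus_commute)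
  qed
  then show ?thesis using d(1) by blast
qed

lemma near_unit_tendsto:
  fixes T :: "'a \<Rightarrow> 'a \<Rightarrow> 'a"
  assumes T: "\<And>r. 0 < r \<Longrightarrow> \<exists>d>0. \<forall>x\<in>\<Omega>. dist x e < d \<longrightarrow> (\<forall>y. norm (T x y - y) \<le> r * norm y)"
    and x: "(x \<longlongrightarrow> e) F" and y: "(y \<longlongrightarrow> y0) F"
  shows "((\<lambda>n. T (x n) (y n)) \<longlongrightarrow> y0) F"
proof -
  have "((\<lambda>n. T (x n) (y n) - y n) \<longlongrightarrow> 0) F"
  proof (rule tendstoI)
    fix r :: real assume "r > 0"
    define M where "M = norm y0 + 1"
    have "M > 0" by (simp add: M_def add_nonneg_pos)
    then have "r / (2 * M) > 0" using \<open>r > 0\<close> by simp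
    from T[OF this] obtain d where d: "d > 0"
      "\<And>x y. x \<in> \<Omega> \<Longrightarrow> dist x e < d \<Longrightarrow> norm (T x y - y) \<le> r / (2 * M) * norm y" by blast
    have "\<forall>\<^sub>F n in F. norm (y n) < M"
      using order_tendstoD(2)[OF tendsto_norm[OF y], of M] by (simp add: M_def)
    with topological_tendstoD[OF x cone_open unit_in_cone] tendstoD[OF x d(1)]
    show "\<forall>\<^sub>F n in F. dist (T (x n) (y n) - y n) 0 < r"
    proof eventually_elim
      case (elim n)
      have "norm (T (x n) (y n) - y n) \<le> r / (2 * M) * norm (y n)" using d(2) elim by blast
      also have "\<dots> \<le> r / (2 * M) * M"
        using elim \<open>r / (2 * M) > 0\<close> by (intro mult_left_mono) auto
      also have "\<dots> < r" using \<open>M > 0\<close> \<open>r > 0\<close> by simp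
      finally show ?case by simp
    qed
  qed
  from tendsto_add[OF this y] show ?thesis by simp
qed

lemma W_tendsto: "(x \<longlongrightarrow> e) F \<Longrightarrow> (y \<longlongrightarrow> y0) F \<Longrightarrow> ((\<lambda>n. W (x n) (y n)) \<longlongrightarrow> y0) F"
  by (rule near_unit_tendsto[OF W_near_unit])

lemma V_tendsto: "(x \<longlongrightarrow> e) F \<Longrightarrow> (y \<longlongrightarrow> y0) F \<Longrightarrow> ((\<lambda>n. V (x n) (y n)) \<longlongrightarrow> y0) F"
  by (rule near_unit_tendsto[OF V_near_unit])

definition is_log :: "('a \<Rightarrow> real) \<Rightarrow> bool" where
  "is_log N \<longleftrightarrow> (\<forall>x\<in>\<Omega>. \<forall>y\<in>\<Omega>. N (W x y) = N x + N y)"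

lemma log_V: "is_log N \<Longrightarrow> x \<in> \<Omega> \<Longrightarrow> y \<in> \<Omega> \<Longrightarrow> N (V x y) = N y - N x"
  using V_in_cone_iff[of x y] W_V[of x y] unfolding is_log_def by force

lemma log_scale: "is_log N \<Longrightarrow> x \<in> \<Omega> \<Longrightarrow> 0 < s \<Longrightarrow> N (s *\<^sub>R x) = N (s *\<^sub>R e) + N x"
  using W_scaled_unit[of s x] cone_scale[of s e] unit_in_cone unfolding is_log_def by force

lemma log_e: "is_log N \<Longrightarrow> N e = 0"
  using W_unit[of e] unit_in_cone unfolding is_log_def by force

text \<open>
A function on \<open>D\<close> that is logarithmic as long as all arguments stay in \<open>D\<close> extends to the cone: scale the
argument into \<open>D\<close> and subtract the value of the scalar used. The rule for \<open>p = s e\<close> shows that the result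
does not depend on the scalar, and homogeneity reduces the logarithmic rule for arbitrary \<open>x\<close> and \<open>y\<close>
to the local one.
\<close>

theorem local_log_extends:
  assumes cont: "continuous_on D \<eta>"
    and local: "\<And>p r. p \<in> D \<Longrightarrow> r \<in> \<Omega> \<Longrightarrow> p - r \<in> \<Omega> \<Longrightarrow> \<eta> (V p r) = \<eta> r - \<eta> p"
  obtains H where "continuous_on \<Omega> H" "is_log H" "\<And>x. x \<in> D \<Longrightarrow> H x = \<eta> x"
proof -
  \<comment> \<open>any scalar that moves \<open>x\<close> into \<open>D\<close> serves; \<open>indep\<close> below shows that the choice is immaterial\<close>
  define H where "H x = (let t = (SOME t. 0 < t \<and> t < 1 \<and> t *\<^sub>R x \<in> D) in \<eta> (t *\<^sub>R x) - \<eta> (t *\<^sub>R e))" for x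
  have scale: "\<eta> (s *\<^sub>R x) = \<eta> (s *\<^sub>R e) + \<eta> x" if "x \<in> D" "0 < s" "s < 1" for x s
  proof -
    have "s *\<^sub>R e - s *\<^sub>R x \<in> \<Omega>" using that cone_scale[of s "e - x"] by (simp add: D_iff algebra_simps)
    then have "\<eta> (V (s *\<^sub>R e) (s *\<^sub>R x)) = \<eta> (s *\<^sub>R x) - \<eta> (s *\<^sub>R e)"
      using that by (intro local scaled_unit_in_D cone_scale) (auto simp: D_iff)
    then show ?thesis using that by (simp add: V_scaled_unit)
  qed
  have indep: "\<eta> (t *\<^sub>R x) - \<eta> (t *\<^sub>R e) = \<eta> (s *\<^sub>R x) - \<eta> (s *\<^sub>R e)"
    if "x \<in> \<Omega>" "0 < t" "t < s" "s < 1" "s *\<^sub>R x \<in> D" for x s t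
  proof -
    have "\<eta> ((t / s) *\<^sub>R s *\<^sub>R x) = \<eta> ((t / s) *\<^sub>R e) + \<eta> (s *\<^sub>R x)"
      "\<eta> ((t / s) *\<^sub>R s *\<^sub>R e) = \<eta> ((t / s) *\<^sub>R e) + \<eta> (s *\<^sub>R e)"
      using that by (intro scale scaled_unit_in_D; simp)+
    then show ?thesis using that by simp
  qed
  have H: "H x = \<eta> (t *\<^sub>R x) - \<eta> (t *\<^sub>R e)" if "x \<in> \<Omega>" "0 < t" "t < 1" "t *\<^sub>R x \<in> D" for x t
  proof -
    define s where "s = (SOME t. 0 < t \<and> t < 1 \<and> t *\<^sub>R x \<in> D)"
    have s: "0 < s \<and> s < 1 \<and> s *\<^sub>R x \<in> D" unfolding s_def by (rule someI[of _ t]) (use that in auto)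
    have "H x = \<eta> (s *\<^sub>R x) - \<eta> (s *\<^sub>R e)" by (simp add: H_def s_def Let_def)
    also have "\<dots> = \<eta> (t *\<^sub>R x) - \<eta> (t *\<^sub>R e)"
    proof (cases s t rule: linorder_cases)
      case less
      then show ?thesis using s that by (intro indep) auto
    next
      case greater
      then show ?thesis using s that by (intro indep[symmetric]) auto
    qed simp
    finally show ?thesis .
  qed
  have HD: "H x = \<eta> x" if "x \<in> D" for x
    using H[of x "1/2"] scale[of x "1/2"] scaled_D[of x "1/2"] that by (simp add: D_iff)
  have cont': "continuous_on \<Omega> H"
  proof (intro continuous_at_imp_continuous_on ballI)
    fix x assume x: "x \<in> \<Omega>"
    obtain t where t: "0 < t" "t < 1" "t *\<^sub>R x \<in> D" using obtain_scale[OF x] by blast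
    have lim: "((\<lambda>y. t *\<^sub>R y) \<longlongrightarrow> t *\<^sub>R x) (at x)" by (intro tendsto_intros)
    have "((\<lambda>y. \<eta> (t *\<^sub>R y) - \<eta> (t *\<^sub>R e)) \<longlongrightarrow> \<eta> (t *\<^sub>R x) - \<eta> (t *\<^sub>R e)) (at x)"
      by (intro tendsto_intros tendsto_D[OF cont lim] t)
    moreover have "\<forall>\<^sub>F y in at x. \<eta> (t *\<^sub>R y) - \<eta> (t *\<^sub>R e) = H y"
      using eventually_in_D[OF lim t(3)] topological_tendstoD[OF tendsto_ident_at cone_open x]
      by eventually_elim (use H t in auto)
    ultimately show "isCont H x"
      unfolding isCont_def H[OF x t] by (rule Lim_transform_eventually)
  qed
  have Hscale: "H (s *\<^sub>R x) = H (s *\<^sub>R e) + H x" if x: "x \<in> \<Omega>" and s: "0 < s" for x s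
  proof -
    have lim: "((\<lambda>t. t * s) \<longlongrightarrow> 0) (at_right 0)"
      by (auto intro!: tendsto_eq_intros)
    have "\<forall>\<^sub>F t in at_right (0::real). 0 < t \<and> t < 1 \<and> t * s < 1"
      using order_tendstoD(2)[OF lim zero_less_one] eventually_at_right_less[of "0::real"]
        eventually_at_right_less_1
      by eventually_elim auto
    then have "\<forall>\<^sub>F t in at_right (0::real). 0 < t \<and> t < 1 \<and> t * s < 1 \<and> t *\<^sub>R x \<in> D \<and> t *\<^sub>R s *\<^sub>R x \<in> D \<and> t *\<^sub>R s *\<^sub>R e \<in> D"
      using eventually_scaled_in_D[OF x] eventually_scaled_in_D[OF cone_scale[OF s x]]
        eventually_scaled_in_D[OF cone_scale[OF s unit_in_cone]]
      by eventually_elim auto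
    then obtain t where t: "0 < t" "t < 1" "t * s < 1" "t *\<^sub>R x \<in> D" "t *\<^sub>R s *\<^sub>R x \<in> D" "t *\<^sub>R s *\<^sub>R e \<in> D"
      using eventually_happens'[OF trivial_limit_at_right_real] by blast
    have "H (s *\<^sub>R x) = \<eta> (t *\<^sub>R s *\<^sub>R x) - \<eta> (t *\<^sub>R e)" "H (s *\<^sub>R e) = \<eta> (t *\<^sub>R s *\<^sub>R e) - \<eta> (t *\<^sub>R e)"
      using t x s by (intro H cone_scale unit_in_cone; simp)+
    moreover have "H x = \<eta> ((t * s) *\<^sub>R x) - \<eta> ((t * s) *\<^sub>R e)"
      using t x s by (intro H) auto
    ultimately show ?thesis by simp
  qed
  have "H (W x y) = H x + H y" if x: "x \<in> \<Omega>" and y: "y \<in> \<Omega>" for x y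
  proof -
    have z: "W x y \<in> \<Omega>" using x y by (simp add: W_in_cone_iff)
    obtain t where t: "0 < t" "t < 1" "t *\<^sub>R x \<in> D" using obtain_scale[OF x] by blast
    have tx: "t *\<^sub>R x \<in> \<Omega>" using t by (simp add: D_iff)
    have "\<forall>\<^sub>F s in at_right (0::real). 0 < s \<and> t *\<^sub>R x - s *\<^sub>R W x y \<in> \<Omega>"
      using eventually_minus_scaled[OF tx, of "W x y"] eventually_at_right_less[of "0::real"]
      by eventually_elim auto
    then obtain s where s: "0 < s" "t *\<^sub>R x - s *\<^sub>R W x y \<in> \<Omega>"
      using eventually_happens'[OF trivial_limit_at_right_real] by blast
    have "\<eta> (V (t *\<^sub>R x) (s *\<^sub>R W x y)) = \<eta> (s *\<^sub>R W x y) - \<eta> (t *\<^sub>R x)"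
      using t s z by (intro local cone_scale) auto
    moreover have "V (t *\<^sub>R x) (s *\<^sub>R W x y) = (s / t) *\<^sub>R y"
      using t x by (simp add: V_scale V_scaleR V_W)
    moreover have "s *\<^sub>R W x y \<in> D"
      using s(1) z cone_add[OF s(2)] t(3) cone_scale[of s "W x y"]
      cone_add[OF s(2), of "e - t *\<^sub>R x"] by (simp add: D_iff)
    moreover have "(s / t) *\<^sub>R y \<in> D"
    proof -
      have "V (t *\<^sub>R x) (t *\<^sub>R x - s *\<^sub>R W x y) \<in> \<Omega>" using s(2) tx by (simp add: V_in_cone_iff)
      then have "e - (s / t) *\<^sub>R y \<in> \<Omega>"
        using t x tx by (simp add: V_diff V_self) (simp add: V_scale V_scaleR V_W)
      then show ?thesis using s t y cone_scale[of "s / t" y] by (simp add: D_iff)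
    qed
    ultimately have "H ((s / t) *\<^sub>R y) = H (s *\<^sub>R W x y) - H (t *\<^sub>R x)"
      using HD t(3) by simp
    moreover have "H (s *\<^sub>R e) = H ((s / t) *\<^sub>R e) + H (t *\<^sub>R e)"
      using Hscale[of "t *\<^sub>R e" "s / t"] t s cone_scale[OF t(1) unit_in_cone] by simp
    ultimately show ?thesis
      using Hscale[OF y, of "s / t"] Hscale[OF z s(1)] Hscale[OF x t(1)] s t by simp
  qed
  then have "is_log H" by (simp add: is_log_def)
  with that cont' HD show ?thesis by blast
qed

end

section \<open>Splitting off logarithmic summands\<close>

locale two_algorithms =
  open_cone \<Omega> e +
  A1: normalized_algorithm \<Omega> e W V + A2: normalized_algorithm \<Omega> e W' V'
  for \<Omega> :: "'a::euclidean_space set" and e W V W' V'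
begin

text \<open>
The limit of the equation for \<open>y = r z\<close> with \<open>r\<close> tending to \<open>0\<close>. The functions \<open>g\<close> and \<open>h\<close> may be
singular at \<open>0\<close>, but the difference \<open>h (r z) - g (r V (e - x) z)\<close> has the limit \<open>f x - k x\<close>. Two values
of \<open>x\<close> give a limit of differences of \<open>g\<close> alone, and its independence of \<open>z\<close> is the logarithmic rule.
Continuity of the limit comes from that of \<open>f - k\<close>.
\<close>

lemma unmatched_pair_differs_by_log:
  fixes f g h k :: "'a \<Rightarrow> real"
  assumes f: "continuous_on D f" and k: "continuous_on D k"
    and eq: "\<And>x y. x \<in> D \<Longrightarrow> y \<in> D \<Longrightarrow> x + y \<in> D \<Longrightarrow>
      f x + g (V (e - x) y) = h y + k (V' (e - y) x)"
  obtains N c where "continuous_on \<Omega> N" "A1.is_log N"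
    "\<And>x. x \<in> D \<Longrightarrow> f x = k x + c + N (e - x)"
proof -
  define \<phi> where "\<phi> x = f x - k x" for x
  have cont: "continuous_on D \<phi>" unfolding \<phi>_def by (intro continuous_intros f k)
  have lim1: "((\<lambda>r. h (r *\<^sub>R z) - g (r *\<^sub>R V (e - x) z)) \<longlongrightarrow> \<phi> x) (at_right 0)"
    if x: "x \<in> D" and z: "z \<in> \<Omega>" for x z
  proof -
    have ex: "e - x \<in> \<Omega>" using x by (simp add: D_iff)
    have r: "((\<lambda>r. e - r *\<^sub>R z) \<longlongrightarrow> e) (at_right 0)" by (auto intro!: tendsto_eq_intros)
    have "((\<lambda>r. f x - k (V' (e - r *\<^sub>R z) x)) \<longlongrightarrow> f x - k x) (at_right 0)"
      by (intro tendsto_intros tendsto_D[OF k] A2.V_tendsto r x)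
    moreover have "\<forall>\<^sub>F r in at_right 0. f x - k (V' (e - r *\<^sub>R z) x) = h (r *\<^sub>R z) - g (r *\<^sub>R V (e - x) z)"
      using eventually_scaled_in_D[OF z] eventually_minus_scaled[OF ex, of z]
    proof eventually_elim
      case (elim r)
      then have "x + r *\<^sub>R z \<in> D"
        using x cone_add[of x "r *\<^sub>R z"] by (simp add: D_iff algebra_simps)
      from eq[OF x elim(1) this] show ?case
        by (simp add: A1.V_scaleR[OF ex])
    qed
    ultimately show ?thesis unfolding \<phi>_def by (rule Lim_transform_eventually)
  qed
  \<comment> \<open>subtract \<open>lim1\<close> at \<open>e - t x\<close> and at \<open>e - t e\<close>, then substitute \<open>t r\<close> for \<open>r\<close>: this extends the
     range from \<open>x\<close> in \<open>D\<close> to the whole cone\<close>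
  have lim2: "((\<lambda>r. g (r *\<^sub>R z) - g (r *\<^sub>R V x z)) \<longlongrightarrow> \<phi> (e - t *\<^sub>R x) - \<phi> (e - t *\<^sub>R e)) (at_right 0)"
    if x: "x \<in> \<Omega>" and t: "0 < t" "t < 1" "t *\<^sub>R x \<in> D" and z: "z \<in> \<Omega>" for x z t
  proof -
    have "((\<lambda>r. (h (r *\<^sub>R z) - g (r *\<^sub>R V (e - (e - t *\<^sub>R x)) z))
        - (h (r *\<^sub>R z) - g (r *\<^sub>R V (e - (e - t *\<^sub>R e)) z))) \<longlongrightarrow> \<phi> (e - t *\<^sub>R x) - \<phi> (e - t *\<^sub>R e)) (at_right 0)"
      using t by (intro tendsto_diff lim1 D_complement scaled_unit_in_D z)
    from tendsto_at_right_0_scale[OF this t(1)] show ?thesis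
      using t x by (simp add: A1.V_scale A1.V_unit unit_in_cone)
  qed
  define N where "N x = Lim (at_right 0) (\<lambda>r. g (r *\<^sub>R e) - g (r *\<^sub>R V x e))" for x
  have N: "N x = \<phi> (e - t *\<^sub>R x) - \<phi> (e - t *\<^sub>R e)" if "x \<in> \<Omega>" "0 < t" "t < 1" "t *\<^sub>R x \<in> D" for x t
    unfolding N_def by (rule tendsto_Lim[OF trivial_limit_at_right_real lim2[OF that unit_in_cone]])
  have limN: "((\<lambda>r. g (r *\<^sub>R z) - g (r *\<^sub>R V x z)) \<longlongrightarrow> N x) (at_right 0)"
    if x: "x \<in> \<Omega>" and z: "z \<in> \<Omega>" for x z
  proof -
    obtain t where t: "0 < t" "t < 1" "t *\<^sub>R x \<in> D" using obtain_scale[OF x] by blast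
    show ?thesis unfolding N[OF x t] by (rule lim2[OF x t z])
  qed
  have "N (W x y) = N x + N y" if x: "x \<in> \<Omega>" and y: "y \<in> \<Omega>" for x y
  proof -
    have u: "W x y \<in> \<Omega>" using x y by (simp add: A1.W_in_cone_iff)
    \<comment> \<open>telescoping: \<open>V x\<close> sends \<open>W x y\<close> to \<open>y\<close>, and \<open>V y\<close> sends \<open>y\<close> to \<open>e\<close>\<close>
    have "((\<lambda>r. (g (r *\<^sub>R W x y) - g (r *\<^sub>R V x (W x y))) + (g (r *\<^sub>R y) - g (r *\<^sub>R V y y)))
        \<longlongrightarrow> N x + N y) (at_right 0)"
      by (intro tendsto_add limN x y u)
    then have "((\<lambda>r. g (r *\<^sub>R W x y) - g (r *\<^sub>R V (W x y) (W x y))) \<longlongrightarrow> N x + N y) (at_right 0)"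
      using x y u by (simp add: A1.V_W A1.V_self)
    with limN[OF u u] show ?thesis using tendsto_unique[OF trivial_limit_at_right_real] by blast
  qed
  then have log: "A1.is_log N" by (simp add: A1.is_log_def)
  have "continuous_on \<Omega> N"
  proof (intro continuous_at_imp_continuous_on ballI)
    fix x assume x: "x \<in> \<Omega>"
    obtain t where t: "0 < t" "t < 1" "t *\<^sub>R x \<in> D" using obtain_scale[OF x] by blast
    have lim: "((\<lambda>y. t *\<^sub>R y) \<longlongrightarrow> t *\<^sub>R x) (at x)" by (intro tendsto_intros)
    have "((\<lambda>y. \<phi> (e - t *\<^sub>R y) - \<phi> (e - t *\<^sub>R e)) \<longlongrightarrow> \<phi> (e - t *\<^sub>R x) - \<phi> (e - t *\<^sub>R e)) (at x)"
      by (intro tendsto_intros tendsto_D[OF cont] D_complement t)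
    moreover have "\<forall>\<^sub>F y in at x. \<phi> (e - t *\<^sub>R y) - \<phi> (e - t *\<^sub>R e) = N y"
      using eventually_in_D[OF lim t(3)] topological_tendstoD[OF tendsto_ident_at cone_open x]
      by eventually_elim (use N t in auto)
    ultimately show "isCont N x"
      unfolding isCont_def N[OF x t] by (rule Lim_transform_eventually)
  qed
  moreover have "f x = k x + (\<phi> ((1/2) *\<^sub>R e) + N (2 *\<^sub>R e)) + N (e - x)" if x: "x \<in> D" for x
  proof -
    have y: "e - x \<in> \<Omega>" using x by (simp add: D_iff)
    have "N (2 *\<^sub>R (e - x)) = \<phi> (e - (1/2) *\<^sub>R 2 *\<^sub>R (e - x)) - \<phi> (e - (1/2) *\<^sub>R e)"
      using x y by (intro N cone_scale) (simp_all add: D_complement)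
    moreover have "e - (1/2) *\<^sub>R e = (1/2) *\<^sub>R e"
      using scaleR_left_diff_distrib[of 1 "1/2" e] by simp
    ultimately show ?thesis
      using A1.log_scale[OF log y, of 2] by (simp add: \<phi>_def)
  qed
  ultimately show ?thesis using log that by blast
qed

end

section \<open>The symmetric equation\<close>

text \<open>
The equation that remains when the logarithmic summands have been split off, with the variables
\<open>u = e - x\<close> and \<open>v = e - y\<close> and with \<open>A\<close> and \<open>B\<close> the remainders of \<open>g\<close> and \<open>k\<close>, reflected at \<open>e\<close>. It
is invariant under exchanging the two algorithms together with \<open>A\<close> and \<open>B\<close>, up to the sign of \<open>d\<close>.
\<close>

locale symmetric_equation = two_algorithms \<Omega> e W V W' V'
  for \<Omega> :: "'a::euclidean_space set" and e W V W' V' +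
  fixes A B :: "'a \<Rightarrow> real" and d :: real
  assumes cont_A: "continuous_on D A" and cont_B: "continuous_on D B"
    and eq: "\<And>u v. u \<in> D \<Longrightarrow> v \<in> D \<Longrightarrow> u + v - e \<in> \<Omega> \<Longrightarrow>
      B u + A (V u (u + v - e)) + d = A v + B (V' v (u + v - e))"
begin

definition \<theta> where "\<theta> r = A (e - r *\<^sub>R e)"

lemma unit_minus: "e - r *\<^sub>R e = (1 - r) *\<^sub>R e"
  by (simp add: algebra_simps)

lemma \<theta>_ratio:
  assumes s: "0 < s" "s < 1"
  shows "((\<lambda>r. \<theta> (r / s) - \<theta> r) \<longlongrightarrow> - d) (at_right 0)"
proof -
  have sD: "s *\<^sub>R e \<in> D" using s scaled_unit_in_D by blast
  have "((\<lambda>r. ((s - r) / (1 - r)) *\<^sub>R e) \<longlongrightarrow> ((s - 0) / (1 - 0)) *\<^sub>R e) (at_right 0)"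
    by (intro tendsto_intros) auto
  then have lim: "((\<lambda>r. ((s - r) / (1 - r)) *\<^sub>R e) \<longlongrightarrow> s *\<^sub>R e) (at_right 0)" by simp
  have "((\<lambda>r. B (((s - r) / (1 - r)) *\<^sub>R e) - B (s *\<^sub>R e) - d) \<longlongrightarrow> B (s *\<^sub>R e) - B (s *\<^sub>R e) - d) (at_right 0)"
    by (intro tendsto_intros tendsto_D[OF cont_B lim] sD)
  moreover have "\<forall>\<^sub>F r in at_right 0. B (((s - r) / (1 - r)) *\<^sub>R e) - B (s *\<^sub>R e) - d = \<theta> (r / s) - \<theta> r"
    using eventually_at_right_real[OF s(1)]
  proof eventually_elim
    case (elim r)
    then have r: "0 < r" "r < s" by auto
    have u: "s *\<^sub>R e + (1 - r) *\<^sub>R e - e = (s - r) *\<^sub>R e" by (simp add: algebra_simps)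
    have "B (s *\<^sub>R e) + A (V (s *\<^sub>R e) ((s - r) *\<^sub>R e)) + d
        = A ((1 - r) *\<^sub>R e) + B (V' ((1 - r) *\<^sub>R e) ((s - r) *\<^sub>R e))"
      using eq[of "s *\<^sub>R e" "(1 - r) *\<^sub>R e"] sD scaled_unit_in_D[of "1 - r"] r s
        cone_scale[of "s - r" e] unit_in_cone unfolding u by simp
    moreover have "(s - r) / s = 1 - r / s" using s by (simp add: field_simps)
    ultimately show ?case
      using r s by (simp add: A1.V_scaled_unit A2.V_scaled_unit \<theta>_def unit_minus)
  qed
  ultimately show ?thesis by (auto intro: Lim_transform_eventually)
qed

text \<open>
The limit \<open>- d\<close> is the same for all ratios, whereas limits for ratios \<open>2\<close> and \<open>2\<close> add up to the one for
ratio \<open>4\<close>.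
\<close>

lemma d_zero: "d = 0"
proof -
  have "((\<lambda>r. (\<theta> (2 * r / (1/2)) - \<theta> (2 * r)) + (\<theta> (r / (1/2)) - \<theta> r)) \<longlongrightarrow> - d + - d) (at_right 0)"
    by (intro tendsto_add tendsto_at_right_0_scale[where c = 2] \<theta>_ratio) auto
  then have "((\<lambda>r. \<theta> (r / (1/4)) - \<theta> r) \<longlongrightarrow> - d + - d) (at_right 0)"
    by (simp add: mult.commute)
  moreover have "((\<lambda>r. \<theta> (r / (1/4)) - \<theta> r) \<longlongrightarrow> - d) (at_right 0)"
    by (intro \<theta>_ratio) auto
  ultimately have "- d + - d = - d"
    by (rule tendsto_unique[OF trivial_limit_at_right_real])
  then show ?thesis by simp
qed

text \<open>
Uniformly over an order interval of directions \<open>z\<close>, the values of \<open>A\<close> at \<open>e - r z\<close> and at a point on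
the axis agree in the limit. By surjectivity \<open>z = V u0 e\<close>, and the bounds on \<open>z\<close> carry over to \<open>u0\<close>. For
\<open>u = (s / 2) u0\<close> and \<open>v = (1 - s r / 2) e\<close> the equation turns the difference of the two values of \<open>A\<close>
into a difference of values of \<open>B\<close> at points that approach each other inside a compact subset of \<open>D\<close>.
\<close>

lemma near_vertex_compare:
  assumes s: "0 < s" "s < 1" and "\<rho> > 0"
  shows "\<exists>\<delta>>0. \<forall>r z. 0 < r \<longrightarrow> r < \<delta> \<longrightarrow> z - s *\<^sub>R e \<in> \<Omega> \<longrightarrow> e - s *\<^sub>R z \<in> \<Omega> \<longrightarrow>
    \<bar>A (e - r *\<^sub>R z) - \<theta> (s * r / 2)\<bar> < \<rho>"
proof -
  \<comment> \<open>an order interval that contains both arguments of \<open>B\<close>; the factors leave room for the shift by \<open>r' e\<close>\<close>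
  define K where "K = {x. x - (s\<^sup>2/8) *\<^sub>R e \<in> closure \<Omega> \<and> (3/4) *\<^sub>R e - x \<in> closure \<Omega>}"
  have sq: "0 < s\<^sup>2" "s\<^sup>2 < 1" using s by (simp_all add: power_less_one_iff)
  have "K \<subseteq> D"
  proof
    fix x assume x: "x \<in> K"
    have "(s\<^sup>2/8) *\<^sub>R e + (x - (s\<^sup>2/8) *\<^sub>R e) \<in> \<Omega>"
      using x sq by (intro closure_cone_add cone_scale unit_in_cone) (auto simp: K_def)
    moreover have "(1/4) *\<^sub>R e + ((3/4) *\<^sub>R e - x) \<in> \<Omega>"
      using x by (intro closure_cone_add cone_scale unit_in_cone) (auto simp: K_def)
    moreover have "(1/4) *\<^sub>R e + ((3/4) *\<^sub>R e - x) = (1/4 + 3/4) *\<^sub>R e - x"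
      by (simp only: scaleR_left_distrib add_diff_eq)
    ultimately show "x \<in> D" by (simp add: D_iff)
  qed
  moreover have "closed K"
  proof -
    have "K = (\<lambda>x. x - (s\<^sup>2/8) *\<^sub>R e) -` closure \<Omega> \<inter> (\<lambda>x. (3/4) *\<^sub>R e - x) -` closure \<Omega>"
      by (auto simp: K_def)
    then show ?thesis by (auto intro!: closed_Int closed_vimage continuous_intros)
  qed
  ultimately have "compact K" using bounded_D bounded_subset compact_eq_bounded_closed by blast
  then have "uniformly_continuous_on K B"
    using cont_B \<open>K \<subseteq> D\<close> continuous_on_subset compact_uniformly_continuous by blast
  then obtain \<delta>0 where \<delta>0: "\<delta>0 > 0" "\<And>x x'. x \<in> K \<Longrightarrow> x' \<in> K \<Longrightarrow> dist x' x < \<delta>0 \<Longrightarrow> dist (B x') (B x) < \<rho>"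
    using \<open>\<rho> > 0\<close> unfolding uniformly_continuous_on_def by metis
  obtain R where R: "R > 0" "\<And>x. x \<in> D \<Longrightarrow> norm x \<le> R"
    using bounded_D bounded_pos by metis
  define \<delta> where "\<delta> = min (s\<^sup>2/4) (\<delta>0 / (2 * R))"
  have "\<delta> > 0" using sq \<delta>0 R by (simp add: \<delta>_def)
  have "\<bar>A (e - r *\<^sub>R z) - \<theta> (s * r / 2)\<bar> < \<rho>"
    if r: "0 < r" "r < \<delta>" and z: "z - s *\<^sub>R e \<in> \<Omega>" "e - s *\<^sub>R z \<in> \<Omega>" for r z
  proof -
    define r' where "r' = s * r / 2"
    have "s * r < r" using mult_strict_right_mono[OF s(2) r(1)] by simp
    then have "r' < r" unfolding r'_def using r(1) by linarith
    moreover have "r < s\<^sup>2/4" "r < \<delta>0 / (2 * R)" using r(2) by (simp_all add: \<delta>_def)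
    ultimately have r': "0 < r'" "r' < s\<^sup>2/4" "r' < \<delta>0 / (2 * R)" "r' < 1/4"
      using s r(1) sq by (linarith | simp add: r'_def)+
    have "z \<in> \<Omega>" using cone_add_scaled_unit[OF z(1), of s] s by simp
    then obtain u0 where u0: "u0 \<in> \<Omega>" "V u0 e = z" using A1.V_onto by blast
    have Wz: "W u0 z = e" using u0 A1.W_V by blast
    have "W u0 (z - s *\<^sub>R e) \<in> \<Omega>" "W u0 (e - s *\<^sub>R z) \<in> \<Omega>" using z u0 by (simp_all add: A1.W_in_cone_iff)
    then have "e - s *\<^sub>R u0 \<in> \<Omega>" "u0 - s *\<^sub>R e \<in> \<Omega>"
      using u0(1) by (simp_all add: A1.W_diff A1.W_scaleR A1.W_e Wz)
    \<comment> \<open>scaled so that \<open>u\<close> is at most \<open>e / 2\<close>\<close>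
    define u where "u = (s / 2) *\<^sub>R u0"
    have u1: "(1/2) *\<^sub>R e - u \<in> \<Omega>"
      using cone_scale[of "1/2", OF _ \<open>e - s *\<^sub>R u0 \<in> \<Omega>\<close>] by (simp add: u_def algebra_simps)
    have u2: "u - (s\<^sup>2/2) *\<^sub>R e \<in> \<Omega>"
      using cone_scale[of "s/2", OF _ \<open>u0 - s *\<^sub>R e \<in> \<Omega>\<close>] s by (simp add: u_def algebra_simps power2_eq_square)
    define x where "x = (1 / (1 - r')) *\<^sub>R (u - r' *\<^sub>R e)"
    have uK: "u \<in> K"
    proof -
      have "u - (s\<^sup>2/2) *\<^sub>R e + (3 * s\<^sup>2/8) *\<^sub>R e \<in> \<Omega>" "(1/2) *\<^sub>R e - u + (1/4) *\<^sub>R e \<in> \<Omega>"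
        using u1 u2 sq by (intro cone_add_scaled_unit; simp)+
      moreover have "u - (s\<^sup>2/2) *\<^sub>R e + (3 * s\<^sup>2/8) *\<^sub>R e = u - (s\<^sup>2/8) *\<^sub>R e"
        "(1/2) *\<^sub>R e - u + (1/4) *\<^sub>R e = (3/4) *\<^sub>R e - u"
        by (simp_all add: algebra_simps flip: scaleR_left_distrib)
      ultimately show ?thesis using closure_subset[of \<Omega>] by (auto simp: K_def)
    qed
    have xK: "x \<in> K"
    proof -
      have cancel: "(1 / (1 - r')) *\<^sub>R (1 - r') *\<^sub>R y = y" for y :: 'a using r' by simp
      have "s\<^sup>2 / 8 * (1 - r') \<le> s\<^sup>2 / 8 * 1" using r' sq by (intro mult_left_mono) auto
      then have "0 \<le> s\<^sup>2/2 - r' - s\<^sup>2 / 8 * (1 - r')" using r' sq by linarith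
      then have "u - (s\<^sup>2/2) *\<^sub>R e + (s\<^sup>2/2 - r' - s\<^sup>2 / 8 * (1 - r')) *\<^sub>R e \<in> \<Omega>"
        by (rule cone_add_scaled_unit[OF u2])
      moreover have "(1/2) *\<^sub>R e - u + (1/4 + r' / 4) *\<^sub>R e \<in> \<Omega>"
        using r' by (intro cone_add_scaled_unit u1) simp
      ultimately have "(1 / (1 - r')) *\<^sub>R (u - (s\<^sup>2/2) *\<^sub>R e + (s\<^sup>2/2 - r' - s\<^sup>2 / 8 * (1 - r')) *\<^sub>R e) \<in> \<Omega>"
        "(1 / (1 - r')) *\<^sub>R ((1/2) *\<^sub>R e - u + (1/4 + r' / 4) *\<^sub>R e) \<in> \<Omega>"
        using r' by (intro cone_scale; simp)+
      moreover have "x - (s\<^sup>2/8) *\<^sub>R e = (1 / (1 - r')) *\<^sub>R (u - r' *\<^sub>R e - (1 - r') *\<^sub>R (s\<^sup>2/8) *\<^sub>R e)"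
        "(3/4) *\<^sub>R e - x = (1 / (1 - r')) *\<^sub>R ((1 - r') *\<^sub>R (3/4) *\<^sub>R e - (u - r' *\<^sub>R e))"
        unfolding x_def by (simp_all only: scaleR_diff_right cancel)
      moreover have "u - r' *\<^sub>R e - (1 - r') *\<^sub>R (s\<^sup>2/8) *\<^sub>R e
          = u - (s\<^sup>2/2) *\<^sub>R e + (s\<^sup>2/2 - r' - s\<^sup>2 / 8 * (1 - r')) *\<^sub>R e"
        by (simp add: algebra_simps)
      moreover have "(1 - r') *\<^sub>R (3/4) *\<^sub>R e - (u - r' *\<^sub>R e) = (1/2) *\<^sub>R e - u + (1/4 + r' / 4) *\<^sub>R e"
      proof -
        have "(1 - r') * (3/4) + r' = 1/2 + (1/4 + r' / 4)" by (simp add: field_simps)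
        then have "((1 - r') * (3/4)) *\<^sub>R e + r' *\<^sub>R e = (1/2) *\<^sub>R e + (1/4 + r' / 4) *\<^sub>R e"
          by (simp only: scaleR_left_distrib[symmetric])
        then show ?thesis by (simp only: scaleR_scaleR) (metis add_diff_eq diff_add_eq diff_diff_eq2)
      qed
      ultimately have "x - (s\<^sup>2/8) *\<^sub>R e \<in> \<Omega>" "(3/4) *\<^sub>R e - x \<in> \<Omega>" by (simp_all only:)
      then show ?thesis using closure_subset[of \<Omega>] unfolding K_def by blast
    qed
    have uD: "u \<in> D" using uK \<open>K \<subseteq> D\<close> by blast
    have "x - u = (r' / (1 - r')) *\<^sub>R (u - e)"
    proof -
      have "(u - r' *\<^sub>R e) - (1 - r') *\<^sub>R u = r' *\<^sub>R (u - e)" by (simp add: algebra_simps)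
      moreover have "(1 / (1 - r')) *\<^sub>R (1 - r') *\<^sub>R u = u" using r' by simp
      then have "x - u = (1 / (1 - r')) *\<^sub>R ((u - r' *\<^sub>R e) - (1 - r') *\<^sub>R u)"
        unfolding x_def by (simp only: scaleR_diff_right[of "1 / (1 - r')"])
      ultimately show ?thesis by simp
    qed
    then have "dist x u = r' / (1 - r') * norm (u - e)"
      using r' by (simp add: dist_norm)
    also have "\<dots> \<le> (2 * r') * R"
    proof (intro mult_mono)
      show "norm (u - e) \<le> R" using R(2)[OF D_complement[OF uD]] by (simp add: norm_minus_commute)
      show "r' / (1 - r') \<le> 2 * r'" using r' by (simp add: field_simps)
    qed (use r' in auto)
    also have "\<dots> < \<delta>0" using r'(3) R(1) by (simp add: field_simps)
    finally have close: "dist (B x) (B u) < \<rho>" using \<delta>0 uK xK by blast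
    have sum: "u + (1 - r') *\<^sub>R e - e = u - r' *\<^sub>R e" by (simp add: algebra_simps)
    have "u - r' *\<^sub>R e \<in> \<Omega>"
      using cone_add_scaled_unit[OF u2, of "s\<^sup>2/2 - r'"] r' by (simp add: algebra_simps)
    then have "B u + A (V u (u - r' *\<^sub>R e)) = A ((1 - r') *\<^sub>R e) + B (V' ((1 - r') *\<^sub>R e) (u - r' *\<^sub>R e))"
      using eq[OF uD scaled_unit_in_D[of "1 - r'"], unfolded sum] r' d_zero by simp
    moreover have "V u (u - r' *\<^sub>R e) = e - r *\<^sub>R z"
    proof -
      have "u \<in> \<Omega>" using uD by (simp add: D_iff)
      moreover have "V u e = (2 / s) *\<^sub>R z" using u0 s by (simp add: u_def A1.V_scale)
      ultimately show ?thesis using s by (simp add: A1.V_diff A1.V_scaleR A1.V_self r'_def)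
    qed
    moreover have "V' ((1 - r') *\<^sub>R e) (u - r' *\<^sub>R e) = x"
      using r' by (simp add: A2.V_scaled_unit x_def)
    ultimately have "A (e - r *\<^sub>R z) - \<theta> r' = B x - B u"
      by (simp add: \<theta>_def unit_minus)
    then show ?thesis using close by (simp add: dist_real_def r'_def)
  qed
  with \<open>\<delta> > 0\<close> show ?thesis by blast
qed

text \<open>
Compare both \<open>z n\<close> and \<open>e\<close> with the same point on the axis.
\<close>

lemma near_vertex_tendsto:
  assumes r: "(r \<longlongrightarrow> 0) F" "\<forall>\<^sub>F n in F. r n > 0" and z: "(z \<longlongrightarrow> z0) F" "z0 \<in> \<Omega>"
  shows "((\<lambda>n. A (e - r n *\<^sub>R z n) - \<theta> (r n)) \<longlongrightarrow> 0) F"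
proof (rule tendstoI)
  fix \<rho> :: real assume "\<rho> > 0"
  obtain s1 where s1: "0 < s1" "s1 < 1" "\<forall>\<^sub>F x in nhds z0. x - s1 *\<^sub>R e \<in> \<Omega> \<and> e - s1 *\<^sub>R x \<in> \<Omega>"
    using eventually_between[OF z(2)] by blast
  have e1: "e - s1 *\<^sub>R e \<in> \<Omega>" using scaled_unit_in_D[of s1] s1 by (simp add: D_iff)
  obtain \<delta> where \<delta>: "\<delta> > 0" "\<And>r z. 0 < r \<Longrightarrow> r < \<delta> \<Longrightarrow> z - s1 *\<^sub>R e \<in> \<Omega> \<Longrightarrow> e - s1 *\<^sub>R z \<in> \<Omega> \<Longrightarrow>
    \<bar>A (e - r *\<^sub>R z) - \<theta> (s1 * r / 2)\<bar> < \<rho> / 2"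
    using near_vertex_compare[OF s1(1,2), of "\<rho> / 2"] \<open>\<rho> > 0\<close> by auto
  have "\<forall>\<^sub>F n in F. z n - s1 *\<^sub>R e \<in> \<Omega> \<and> e - s1 *\<^sub>R z n \<in> \<Omega>"
    by (rule eventually_compose_filterlim[OF s1(3) z(1)])
  with r(2) order_tendstoD(2)[OF r(1) \<delta>(1)]
  show "\<forall>\<^sub>F n in F. dist (A (e - r n *\<^sub>R z n) - \<theta> (r n)) 0 < \<rho>"
  proof eventually_elim
    case (elim n)
    have "\<bar>A (e - r n *\<^sub>R z n) - \<theta> (s1 * r n / 2)\<bar> < \<rho> / 2"
      by (rule \<delta>(2); use elim in simp)
    moreover have "\<bar>A (e - r n *\<^sub>R e) - \<theta> (s1 * r n / 2)\<bar> < \<rho> / 2"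
      by (rule \<delta>(2); use elim e1 in simp)
    ultimately show ?case unfolding \<theta>_def[of "r n"] dist_real_def by linarith
  qed
qed

text \<open>
The substitution \<open>u = r e\<close>, \<open>v = e - r q\<close>. For it \<open>s = u + v - e\<close> equals \<open>r (e - q)\<close>, and the condition \<open>V' v s = r z\<close> is
equivalent to \<open>V' v e = (e - r z) / (1 - r)\<close>, which surjectivity solves for \<open>v\<close>. The relation
\<open>e - q = W' v z\<close> is recorded because it locates \<open>q\<close> near \<open>e - z\<close> when \<open>r\<close> is small.
\<close>

lemma vertex_substitution:
  assumes r: "0 < r" "r < 1" and z: "z \<in> D"
  obtains q where "q \<in> D" "e - r *\<^sub>R q \<in> \<Omega>" "e - q = W' (e - r *\<^sub>R q) z"
    "B (r *\<^sub>R z) - B (r *\<^sub>R e) = A (e - q) - A (e - r *\<^sub>R q)"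
proof -
  define y where "y = (1 / (1 - r)) *\<^sub>R (e - r *\<^sub>R z)"
  have "e - r *\<^sub>R z \<in> \<Omega>"
    using scaled_D[OF z, of r] r by (simp add: D_iff)
  then have "y \<in> \<Omega>" using r by (simp add: y_def cone_scale)
  then obtain v where v: "v \<in> \<Omega>" "V' v e = y" using A2.V_onto by blast
  define q where "q = (1 / r) *\<^sub>R (e - v)"
  have rq: "r *\<^sub>R q = e - v" using r by (simp add: q_def)
  have "(r / (1 - r)) *\<^sub>R (e - z) \<in> \<Omega>" using r z by (intro cone_scale) (auto simp: D_iff)
  moreover have "V' v (e - v) = (r / (1 - r)) *\<^sub>R (e - z)"
  proof -
    have "(1 - r) *\<^sub>R y = e - r *\<^sub>R z" using r by (simp add: y_def)
    then have "(1 - r) *\<^sub>R (y - e) = r *\<^sub>R (e - z)"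
      unfolding scaleR_diff_right[of "1 - r"] by (simp add: algebra_simps)
    then have "(1 / (1 - r)) *\<^sub>R (1 - r) *\<^sub>R (y - e) = (1 / (1 - r)) *\<^sub>R r *\<^sub>R (e - z)"
      by (rule arg_cong)
    then have "y - e = (r / (1 - r)) *\<^sub>R (e - z)" using r by simp
    then show ?thesis using v by (simp add: A2.V_diff A2.V_self)
  qed
  ultimately have ev: "e - v \<in> \<Omega>" using A2.V_in_cone_iff v(1) by metis
  then have q1: "q \<in> \<Omega>" using r by (simp add: q_def cone_scale)
  have "V' v q = (1 / r) *\<^sub>R (y - e)"
    using v by (simp add: q_def A2.V_scaleR A2.V_diff A2.V_self)
  then have "V' v (e - q) = y - (1 / r) *\<^sub>R (y - e)"
    using v by (simp add: A2.V_diff)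
  also have "\<dots> = z"
  proof -
    have "r *\<^sub>R (y - (1 / r) *\<^sub>R (y - e)) = e - (1 - r) *\<^sub>R y" using r by (simp add: algebra_simps)
    also have "\<dots> = r *\<^sub>R z" using r by (simp add: y_def)
    finally show ?thesis using r by simp
  qed
  finally have Vq: "V' v (e - q) = z" .
  then have q2: "e - q \<in> \<Omega>" using A2.V_in_cone_iff[OF v(1), of "e - q"] z by (simp add: D_iff)
  have q: "q \<in> D" using q1 q2 by (simp add: D_iff)
  have Wq: "e - q = W' v z" using A2.W_V[OF v(1), of "e - q"] Vq by simp
  have vq: "e - r *\<^sub>R q = v" by (simp add: rq)
  have s: "r *\<^sub>R e + v - e = r *\<^sub>R (e - q)" using rq by (simp add: algebra_simps)
  have "B (r *\<^sub>R e) + A (V (r *\<^sub>R e) (r *\<^sub>R (e - q))) = A v + B (V' v (r *\<^sub>R (e - q)))"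
    using eq[of "r *\<^sub>R e" v] v(1) ev q2 r unfolding s
    by (simp add: D_iff[of v] scaled_unit_in_D cone_scale d_zero)
  moreover have "V' v (r *\<^sub>R (e - q)) = r *\<^sub>R z" using v Vq by (simp only: A2.V_scaleR)
  moreover have "V (r *\<^sub>R e) (r *\<^sub>R (e - q)) = e - q" using r by (simp add: A1.V_scaled_unit)
  ultimately show ?thesis using that[of q] q v(1) Wq vq by simp
qed

text \<open>
As \<open>v\<close> tends to \<open>e\<close>, continuity of \<open>W'\<close> at \<open>e\<close> forces \<open>q\<close> to \<open>e - z0\<close>. So \<open>A (e - q)\<close> tends to \<open>A z0\<close>,
and \<open>A (e - r q)\<close> may be replaced by the axis value \<open>\<theta> r\<close>.
\<close>

lemma B_near_zero_plus_\<theta>: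
  assumes r: "(r \<longlongrightarrow> 0) F" "\<forall>\<^sub>F n in F. r n > 0" and z: "(z \<longlongrightarrow> z0) F" "z0 \<in> D"
  shows "((\<lambda>n. B (r n *\<^sub>R z n) - B (r n *\<^sub>R e) + \<theta> (r n)) \<longlongrightarrow> A z0) F"
proof -
  have "\<exists>q. 0 < r \<and> r < 1 \<and> z \<in> D \<longrightarrow> q \<in> D \<and> e - r *\<^sub>R q \<in> \<Omega> \<and> e - q = W' (e - r *\<^sub>R q) z \<and>
    B (r *\<^sub>R z) - B (r *\<^sub>R e) = A (e - q) - A (e - r *\<^sub>R q)" for r z
    using vertex_substitution[of r z] by blast
  then obtain Q where Q: "\<And>r z. 0 < r \<Longrightarrow> r < 1 \<Longrightarrow> z \<in> D \<Longrightarrow> Q r z \<in> D \<and> e - r *\<^sub>R Q r z \<in> \<Omega> \<and>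
      e - Q r z = W' (e - r *\<^sub>R Q r z) z \<and>
      B (r *\<^sub>R z) - B (r *\<^sub>R e) = A (e - Q r z) - A (e - r *\<^sub>R Q r z)"
    by metis
  define q where "q n = Q (r n) (z n)" for n
  have "\<forall>\<^sub>F n in F. r n > 0 \<and> r n < 1 \<and> z n \<in> D"
    using r(2) order_tendstoD(2)[OF r(1) zero_less_one] eventually_in_D[OF z] by eventually_elim auto
  then have q: "\<forall>\<^sub>F n in F. q n \<in> D" "\<forall>\<^sub>F n in F. e - q n = W' (e - r n *\<^sub>R q n) (z n)"
    "\<forall>\<^sub>F n in F. B (r n *\<^sub>R z n) - B (r n *\<^sub>R e) = A (e - q n) - A (e - r n *\<^sub>R q n)"
    by (auto elim!: eventually_mono simp: q_def Q)
  obtain R where R: "\<And>x. x \<in> D \<Longrightarrow> norm x \<le> R" using bounded_D bounded_iff by metis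
  have "((\<lambda>n. r n *\<^sub>R q n) \<longlongrightarrow> 0) F"
  proof (rule Lim_null_comparison)
    show "\<forall>\<^sub>F n in F. norm (r n *\<^sub>R q n) \<le> r n * R"
      using q(1) r(2) by eventually_elim (auto intro!: mult_left_mono R)
    show "((\<lambda>n. r n * R) \<longlongrightarrow> 0) F" using tendsto_mult[OF r(1) tendsto_const, of R] by simp
  qed
  from tendsto_diff[OF tendsto_const this, of e]
  have "((\<lambda>n. e - r n *\<^sub>R q n) \<longlongrightarrow> e) F" by simp
  from A2.W_tendsto[OF this z(1)] have "((\<lambda>n. e - q n) \<longlongrightarrow> z0) F"
    using q(2) by (auto elim!: Lim_transform_eventually eventually_mono)
  from tendsto_diff[OF tendsto_const this, of e] have q_lim: "(q \<longlongrightarrow> e - z0) F" by simp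
  have "((\<lambda>n. A (e - q n) - (A (e - r n *\<^sub>R q n) - \<theta> (r n))) \<longlongrightarrow> A z0 - 0) F"
    using z(2) by (intro tendsto_diff tendsto_D[OF cont_A] near_vertex_tendsto[OF r q_lim])
      (auto simp: D_iff \<open>((\<lambda>n. e - q n) \<longlongrightarrow> z0) F\<close>)
  then show ?thesis
    using q(3) by (auto elim!: Lim_transform_eventually eventually_mono)
qed

text \<open>
The limit of \<open>A\<close> at \<open>e\<close>, in the form in which it comes out of the three limits combined below.
\<close>

definition A0 where "A0 = 2 * A ((1/2) *\<^sub>R e) - A ((1/4) *\<^sub>R e)"

text \<open>
In \<open>B_near_zero_plus_\<theta>\<close> at \<open>e / 2\<close> for \<open>r\<close>, at \<open>e / 2\<close> for \<open>r / 2\<close> and at \<open>e / 4\<close> for \<open>r\<close>, the values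
of \<open>B\<close> cancel if the third is subtracted from the sum of the first two; what is left is \<open>\<theta> (r / 2)\<close>.
\<close>

lemma \<theta>_tendsto: "(\<theta> \<longlongrightarrow> A0) (at_right 0)"
proof -
  define b where "b r = B (r *\<^sub>R e)" for r
  have L: "((\<lambda>r. b (r * s) - b r + \<theta> r) \<longlongrightarrow> A (s *\<^sub>R e)) (at_right 0)" if "0 < s" "s < 1" for s
    using B_near_zero_plus_\<theta>[OF tendsto_ident_at eventually_at_right_less tendsto_const scaled_unit_in_D[OF that]]
    by (simp add: b_def)
  have "((\<lambda>r. (b (r * (1/2)) - b r + \<theta> r) + (b ((1/2) * r * (1/2)) - b ((1/2) * r) + \<theta> ((1/2) * r)) - (b (r * (1/4)) - b r + \<theta> r))
     \<longlongrightarrow> A ((1/2) *\<^sub>R e) + A ((1/2) *\<^sub>R e) - A ((1/4) *\<^sub>R e)) (at_right 0)"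
    by (intro tendsto_add tendsto_diff L tendsto_at_right_0_scale[where c = "1/2" and F = "\<lambda>r. b (r * (1/2)) - b r + \<theta> r"]) auto
  then have "((\<lambda>r. \<theta> (r / 2)) \<longlongrightarrow> A0) (at_right 0)"
    by (simp add: A0_def mult.commute)
  from tendsto_at_right_0_scale[OF this, of 2] show ?thesis by simp
qed

lemma B_near_zero_tendsto:
  assumes r: "(r \<longlongrightarrow> 0) F" "\<forall>\<^sub>F n in F. r n > 0" and z: "(z \<longlongrightarrow> z0) F" "z0 \<in> D"
  shows "((\<lambda>n. B (r n *\<^sub>R z n) - B (r n *\<^sub>R e)) \<longlongrightarrow> A z0 - A0) F"
proof -
  have "filterlim r (at_right 0) F"
    using r by (auto simp: filterlim_at elim: eventually_mono)
  from tendsto_diff[OF B_near_zero_plus_\<theta>[OF r z] filterlim_compose[OF \<theta>_tendsto this]]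
  show ?thesis by simp
qed

text \<open>
The substitution \<open>u = r p\<close>, \<open>v = e - r (p - x)\<close>, for which \<open>s = u + v - e\<close> equals \<open>r x\<close> and
\<open>V u s = V p x\<close>. As \<open>r\<close> tends to
\<open>0\<close>, \<open>A v\<close> tends to \<open>A0\<close>, and both values of \<open>B\<close> are known from \<open>B_near_zero_tendsto\<close>; the one at
\<open>r V' v x\<close> requires that lemma for a moving direction.
\<close>

lemma A_local_log:
  assumes p: "p \<in> D" and x: "x \<in> \<Omega>" "p - x \<in> \<Omega>"
  shows "A (V p x) = A0 + A x - A p"
proof -
  have xD: "x \<in> D" using x p cone_add[of "e - p" "p - x"] by (simp add: D_iff)
  have pO: "p \<in> \<Omega>" using p by (simp add: D_iff)
  define q where "q = p - x"
  have q: "q \<in> \<Omega>" using x by (simp add: q_def)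
  have id: "((\<lambda>r. r) \<longlongrightarrow> (0::real)) (at_right 0)" by (rule tendsto_ident_at)
  have vlim: "((\<lambda>r. e - r *\<^sub>R q) \<longlongrightarrow> e) (at_right 0)" by (auto intro!: tendsto_eq_intros)
  have near: "((\<lambda>r. A (e - r *\<^sub>R q) - \<theta> r) \<longlongrightarrow> 0) (at_right 0)"
    by (rule near_vertex_tendsto[OF id eventually_at_right_less tendsto_const q])
  have B1: "((\<lambda>r. B (r *\<^sub>R V' (e - r *\<^sub>R q) x) - B (r *\<^sub>R e)) \<longlongrightarrow> A x - A0) (at_right 0)"
    by (rule B_near_zero_tendsto[OF id eventually_at_right_less A2.V_tendsto[OF vlim tendsto_const] xD])
  have B2: "((\<lambda>r. B (r *\<^sub>R p) - B (r *\<^sub>R e)) \<longlongrightarrow> A p - A0) (at_right 0)"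
    by (rule B_near_zero_tendsto[OF id eventually_at_right_less tendsto_const p])
  have "((\<lambda>r. A (e - r *\<^sub>R q) - \<theta> r + \<theta> r + (B (r *\<^sub>R V' (e - r *\<^sub>R q) x) - B (r *\<^sub>R e))
      - (B (r *\<^sub>R p) - B (r *\<^sub>R e))) \<longlongrightarrow> 0 + A0 + (A x - A0) - (A p - A0)) (at_right 0)"
    by (intro tendsto_add tendsto_diff near \<theta>_tendsto B1 B2)
  moreover have "\<forall>\<^sub>F r in at_right 0. A (e - r *\<^sub>R q) - \<theta> r + \<theta> r + (B (r *\<^sub>R V' (e - r *\<^sub>R q) x) - B (r *\<^sub>R e))
      - (B (r *\<^sub>R p) - B (r *\<^sub>R e)) = A (V p x)"
    using eventually_at_right_less[of "0::real"] eventually_scaled_in_D[OF pO] eventually_scaled_in_D[OF q]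
  proof eventually_elim
    case (elim r)
    have v: "e - r *\<^sub>R q \<in> D" using elim(3) by (rule D_complement)
    have s: "r *\<^sub>R p + (e - r *\<^sub>R q) - e = r *\<^sub>R x" by (simp add: q_def algebra_simps)
    have "B (r *\<^sub>R p) + A (V (r *\<^sub>R p) (r *\<^sub>R x)) = A (e - r *\<^sub>R q) + B (V' (e - r *\<^sub>R q) (r *\<^sub>R x))"
      using eq[OF elim(2) v] x(1) elim(1) unfolding s by (simp add: cone_scale d_zero)
    moreover have "V (r *\<^sub>R p) (r *\<^sub>R x) = V p x"
      using elim(1) pO by (simp add: A1.V_scale A1.V_scaleR)
    moreover have "V' (e - r *\<^sub>R q) (r *\<^sub>R x) = r *\<^sub>R V' (e - r *\<^sub>R q) x"
      using v by (simp add: D_iff A2.V_scaleR)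
    ultimately show ?case by simp
  qed
  ultimately have "((\<lambda>r::real. A (V p x)) \<longlongrightarrow> 0 + A0 + (A x - A0) - (A p - A0)) (at_right 0)"
    by (rule Lim_transform_eventually)
  from tendsto_unique[OF trivial_limit_at_right_real tendsto_const this] show ?thesis by simp
qed

lemma A_log:
  obtains H where "continuous_on \<Omega> H" "A1.is_log H" "\<And>x. x \<in> D \<Longrightarrow> A x = A0 + H x"
proof -
  have cont: "continuous_on D (\<lambda>x. A x - A0)" by (intro continuous_intros cont_A)
  have local: "A (V p x) - A0 = (A x - A0) - (A p - A0)"
    if "p \<in> D" "x \<in> \<Omega>" "p - x \<in> \<Omega>" for p x
    using A_local_log[OF that] by simp
  obtain H where H: "continuous_on \<Omega> H" "A1.is_log H" "\<And>x. x \<in> D \<Longrightarrow> H x = A x - A0"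
    using A1.local_log_extends[OF cont local] by blast
  show ?thesis by (rule that[OF H(1,2)]) (simp add: H(3))
qed

text \<open>
Let \<open>\<Delta>\<close> be the difference of the logarithmic functions obtained from \<open>A\<close> and \<open>B\<close>. The equation becomes
\<open>\<Delta> u + \<Delta> v = \<Delta> (u + v - e)\<close>. On multiples of \<open>e\<close> it says \<open>\<Delta> (s\<^sup>2 e) = \<Delta> ((2 s - 1) e)\<close>, and the
quotient \<open>(2 s - 1) / s\<^sup>2\<close> takes every value \<open>t\<close> between \<open>0\<close> and \<open>1\<close>. So \<open>\<Delta> (t e) = 0\<close> for these \<open>t\<close>,
and \<open>\<Delta>\<close> is invariant under scaling. Then \<open>\<Delta> x = \<Delta> ((1 - r) e + r x)\<close>, which tends to \<open>\<Delta> e = 0\<close>.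
\<close>

theorem common_log:
  obtains H B0 where "continuous_on \<Omega> H" "A1.is_log H" "A2.is_log H"
    "\<And>x. x \<in> D \<Longrightarrow> A x = A0 + H x" "\<And>x. x \<in> D \<Longrightarrow> B x = B0 + H x"
proof -
  interpret swap: symmetric_equation \<Omega> e W' V' W V B A "- d"
  proof unfold_locales
    show "A u + B (V' u (u + v - e)) + - d = B v + A (V v (u + v - e))"
      if "u \<in> D" "v \<in> D" "u + v - e \<in> \<Omega>" for u v
      using eq[of v u] that by (simp add: add.commute)
  qed (rule cont_A cont_B)+
  obtain H where H: "continuous_on \<Omega> H" "A1.is_log H" "\<And>x. x \<in> D \<Longrightarrow> A x = A0 + H x"
    using A_log by blast
  obtain H' where H': "continuous_on \<Omega> H'" "A2.is_log H'" "\<And>x. x \<in> D \<Longrightarrow> B x = swap.A0 + H' x"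
    using swap.A_log by blast
  define \<Delta> where "\<Delta> x = H' x - H x" for x
  have scale: "\<Delta> (s *\<^sub>R x) = \<Delta> (s *\<^sub>R e) + \<Delta> x" if "x \<in> \<Omega>" "0 < s" for s x
    using A1.log_scale[OF H(2) that] A2.log_scale[OF H'(2) that] by (simp add: \<Delta>_def)
  have sum: "\<Delta> u + \<Delta> v = \<Delta> (u + v - e)" if uv: "u \<in> D" "v \<in> D" and x: "u + v - e \<in> \<Omega>" for u v
  proof -
    have O: "u \<in> \<Omega>" "v \<in> \<Omega>" using uv by (auto simp: D_iff)
    have xV: "V u (u + v - e) \<in> D"
    proof -
      have "V u (e - v) \<in> \<Omega>" using uv O by (simp add: A1.V_in_cone_iff D_iff)
      moreover have "V u (e - v) = e - V u (u + v - e)"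
        using O by (simp add: A1.V_diff A1.V_add A1.V_self)
      ultimately show ?thesis using x O by (simp add: D_iff A1.V_in_cone_iff)
    qed
    have xV': "V' v (u + v - e) \<in> D"
    proof -
      have "V' v (e - u) \<in> \<Omega>" using uv O by (simp add: A2.V_in_cone_iff D_iff)
      moreover have "V' v (e - u) = e - V' v (u + v - e)"
        using O by (simp add: A2.V_diff A2.V_add A2.V_self)
      ultimately show ?thesis using x O by (simp add: D_iff A2.V_in_cone_iff)
    qed
    show ?thesis
      using eq[OF uv x] A1.log_V[OF H(2) O(1) x] A2.log_V[OF H'(2) O(2) x]
        H(3)[OF xV] H'(3)[OF xV'] H(3)[OF uv(2)] H'(3)[OF uv(1)]
      by (simp add: \<Delta>_def d_zero)
  qed
  have scalar: "\<Delta> (t *\<^sub>R e) = 0" if t: "0 < t" "t < 1" for t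
  proof -
    define w where "w = sqrt (1 - t)"
    have w: "0 < w" "w < 1" "w\<^sup>2 = 1 - t" using t by (auto simp: w_def)
    \<comment> \<open>the solution of \<open>2 s - 1 = t s\<^sup>2\<close> between \<open>1/2\<close> and \<open>1\<close>\<close>
    define s where "s = 1 / (1 + w)"
    have s: "0 < s" "s < 1" using w by (auto simp: s_def)
    have "2 * s - 1 = t * (s * s)"
    proof -
      have "t = (1 + w) * (1 - w)" using w(3) by (simp add: power2_eq_square algebra_simps)
      moreover have "(1 + w) * s = 1" using w by (simp add: s_def)
      ultimately show ?thesis by algebra
    qed
    then have st: "s *\<^sub>R e + s *\<^sub>R e - e = t *\<^sub>R (s * s) *\<^sub>R e"
      by (metis scaleR_left_distrib scaleR_left_diff_distrib scaleR_one mult_2 scaleR_scaleR)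
    have ss: "s * s > 0" using s by simp
    have ssO: "(s * s) *\<^sub>R e \<in> \<Omega>" using ss by (rule cone_scale[OF _ unit_in_cone])
    have "\<Delta> (s *\<^sub>R e) + \<Delta> (s *\<^sub>R e) = \<Delta> (t *\<^sub>R (s * s) *\<^sub>R e)"
      using sum[of "s *\<^sub>R e" "s *\<^sub>R e"] s t ssO unfolding st by (simp add: scaled_unit_in_D cone_scale del: scaleR_scaleR)
    also have "\<dots> = \<Delta> (t *\<^sub>R e) + \<Delta> ((s * s) *\<^sub>R e)" using ssO t(1) by (rule scale)
    also have "\<Delta> ((s * s) *\<^sub>R e) = \<Delta> (s *\<^sub>R e) + \<Delta> (s *\<^sub>R e)"
      using scale[OF cone_scale[OF s(1) unit_in_cone] s(1)] by simp
    finally show ?thesis by simp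
  qed
  have zeroD: "\<Delta> x = 0" if x: "x \<in> D" for x
  proof -
    have xO: "x \<in> \<Omega>" using x by (simp add: D_iff)
    have "((\<lambda>r. (1 - r) *\<^sub>R e + r *\<^sub>R x) \<longlongrightarrow> e) (at_right 0)"
      by (auto intro!: tendsto_eq_intros)
    moreover have "isCont \<Delta> e"
      using H(1) H'(1) cone_open unit_in_cone unfolding \<Delta>_def
      by (auto simp: continuous_on_eq_continuous_at)
    ultimately have "((\<lambda>r. \<Delta> ((1 - r) *\<^sub>R e + r *\<^sub>R x)) \<longlongrightarrow> \<Delta> e) (at_right 0)"
      by (rule isCont_tendsto_compose[rotated])
    moreover have "\<forall>\<^sub>F r in at_right 0. \<Delta> ((1 - r) *\<^sub>R e + r *\<^sub>R x) = \<Delta> x"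
      using eventually_at_right_less[of "0::real"] eventually_at_right_less_1
    proof eventually_elim
      case (elim r)
      define v where "v = (1 - r) *\<^sub>R e + r *\<^sub>R x"
      have rx: "r *\<^sub>R x \<in> \<Omega>" using xO elim by (simp add: cone_scale)
      have "e - v = r *\<^sub>R (e - x)" by (simp add: v_def algebra_simps)
      moreover have "r *\<^sub>R (e - x) \<in> \<Omega>" using x elim by (simp add: cone_scale D_iff)
      ultimately have v: "v \<in> D"
        using cone_add_scaled_unit[OF rx, of "1 - r"] elim by (simp add: D_iff v_def add.commute)
      have "r *\<^sub>R e + v - e = r *\<^sub>R x" by (simp add: v_def algebra_simps)
      then have "\<Delta> (r *\<^sub>R e) + \<Delta> v = \<Delta> (r *\<^sub>R x)"
        using sum[of "r *\<^sub>R e" v] v rx elim by (simp add: scaled_unit_in_D)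
      then show ?case
        using scalar scale[OF xO] elim by (simp add: v_def)
    qed
    ultimately have "((\<lambda>r::real. \<Delta> x) \<longlongrightarrow> \<Delta> e) (at_right 0)" by (rule Lim_transform_eventually)
    from tendsto_unique[OF trivial_limit_at_right_real tendsto_const this] show ?thesis
      using A1.log_e[OF H(2)] A2.log_e[OF H'(2)] by (simp add: \<Delta>_def)
  qed
  have zero: "H' x = H x" if x: "x \<in> \<Omega>" for x
  proof -
    obtain t where t: "0 < t" "t < 1" "t *\<^sub>R x \<in> D" using obtain_scale[OF x] by blast
    have "\<Delta> x = 0" using scale[OF x t(1)] scalar[OF t(1,2)] zeroD[OF t(3)] by simp
    then show ?thesis by (simp add: \<Delta>_def)
  qed
  have "A2.is_log H"
    using H'(2) zero A2.W_in_cone_iff by (simp add: A2.is_log_def)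
  moreover have "B x = swap.A0 + H x" if "x \<in> D" for x
    using H'(3) zero that by (simp add: D_iff)
  ultimately show ?thesis using that H by blast
qed

end

section \<open>The symmetric cone of a Euclidean Jordan algebra\<close>

context jordan_algebra
begin

definition psd where "psd = {x. \<forall>z. 0 \<le> (x \<bullet>\<^sub>J z) \<bullet> z}"

lemma squares_eq_psd: "{x \<bullet>\<^sub>J x | x. True} = psd"
  using squares_iff_mult_nonneg by (auto simp: psd_def)

lemma psd_add: "x \<in> psd \<Longrightarrow> y \<in> psd \<Longrightarrow> x + y \<in> psd"
  by (simp add: psd_def jp_simps inner_add_left add_nonneg_nonneg)

lemma psd_scale: "0 \<le> s \<Longrightarrow> x \<in> psd \<Longrightarrow> s *\<^sub>R x \<in> psd"
  by (simp add: psd_def jp_simps)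

lemma symmetric_cone_eq: "symmetric_cone jp = interior psd"
  unfolding symmetric_cone_def using squares_eq_psd by simp

lemma symmetric_cone_scale:
  assumes "0 < s" "x \<in> symmetric_cone jp"
  shows "s *\<^sub>R x \<in> symmetric_cone jp"
proof -
  have "open ((*\<^sub>R) s ` interior psd)" using assms(1) by (simp add: open_scaling)
  moreover have "(*\<^sub>R) s ` interior psd \<subseteq> psd"
    using assms(1) interior_subset[of psd] psd_scale[of s] by auto
  ultimately show ?thesis
    using assms(2) interior_maximal unfolding symmetric_cone_eq by blast
qed

lemma symmetric_cone_add:
  assumes "x \<in> symmetric_cone jp" "y \<in> symmetric_cone jp"
  shows "x + y \<in> symmetric_cone jp"
proof -
  have "open ((+) y ` interior psd)" by (simp add: open_translation)
  moreover have "(+) y ` interior psd \<subseteq> psd"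
    using assms(2) interior_subset[of psd] psd_add[of y] unfolding symmetric_cone_eq by auto
  ultimately show ?thesis
    using assms(1) interior_maximal[of "(+) y ` interior psd" psd] unfolding symmetric_cone_eq
    by (auto simp: add.commute[of x])
qed

lemma product_bound: obtains C where "C > 0" "\<And>x y. norm (x \<bullet>\<^sub>J y) \<le> C * norm x * norm y"
proof -
  obtain C where "C > 0" "\<forall>x y. norm (x \<bullet>\<^sub>J y) \<le> C * norm x * norm y"
    using bilinear_bounded_pos[OF bilinear] by blast
  then show ?thesis using that by blast
qed

text \<open>
Multiplication by an element near \<open>e\<close> is a small perturbation of the identity and hence positive.
\<close>

lemma unit_in_symmetric_cone: "e \<in> symmetric_cone jp"
proof -
  obtain C where C: "C > 0" "\<And>x y. norm (x \<bullet>\<^sub>J y) \<le> C * norm x * norm y" using product_bound by blast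
  have "x \<in> psd" if x: "x \<in> ball e (1 / C)" for x
    unfolding psd_def
  proof (intro CollectI allI)
    fix z
    have "norm (x - e) < 1 / C" using x by (simp add: dist_norm norm_minus_commute)
    then have small: "C * norm (x - e) \<le> 1" using C(1) by (simp add: field_simps)
    have "\<bar>((x - e) \<bullet>\<^sub>J z) \<bullet> z\<bar> \<le> norm ((x - e) \<bullet>\<^sub>J z) * norm z" by (rule Cauchy_Schwarz_ineq2)
    also have "\<dots> \<le> C * norm (x - e) * norm z * norm z" by (intro mult_right_mono C) auto
    also have "\<dots> \<le> 1 * norm z * norm z" using small by (intro mult_right_mono) auto
    also have "\<dots> = z \<bullet> z" by (simp add: dot_square_norm power2_eq_square)
    finally have "\<bar>((x - e) \<bullet>\<^sub>J z) \<bullet> z\<bar> \<le> z \<bullet> z" .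
    moreover have "(x \<bullet>\<^sub>J z) \<bullet> z = z \<bullet> z + ((x - e) \<bullet>\<^sub>J z) \<bullet> z"
      by (simp add: jp_simps inner_diff_left)
    ultimately show "0 \<le> (x \<bullet>\<^sub>J z) \<bullet> z" by linarith
  qed
  then show ?thesis
    unfolding symmetric_cone_eq mem_interior using C(1) by (intro exI[of _ "1 / C"]) auto
qed

text \<open>
The inner product with \<open>e\<close> of a square \<open>y y\<close> is \<open>y \<bullet> y\<close>. If \<open>x = y y\<close> and \<open>e - x\<close> are squares, this
bounds \<open>y\<close> and hence \<open>x\<close>.
\<close>

lemma bounded_unit_interval: "bounded {x \<in> symmetric_cone jp. e - x \<in> symmetric_cone jp}"
proof -
  obtain C where C: "C > 0" "\<And>x y. norm (x \<bullet>\<^sub>J y) \<le> C * norm x * norm y" using product_bound by blast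
  have sq: "\<exists>y. x = y \<bullet>\<^sub>J y" if "x \<in> symmetric_cone jp" for x
    using that interior_subset unfolding symmetric_cone_def by blast
  have "norm x \<le> C * (e \<bullet> e)" if x: "x \<in> symmetric_cone jp" and ex: "e - x \<in> symmetric_cone jp" for x
  proof -
    obtain y z where y: "x = y \<bullet>\<^sub>J y" and z: "e - x = z \<bullet>\<^sub>J z" using sq[OF x] sq[OF ex] by blast
    have "x \<bullet> e = y \<bullet> y" "(e - x) \<bullet> e = z \<bullet> z"       using inner_square_unit[of y] inner_square_unit[of z] y z by simp_all
    then have "y \<bullet> y + z \<bullet> z = e \<bullet> e" by (simp add: inner_diff_left)
    then have le: "y \<bullet> y \<le> e \<bullet> e" using inner_ge_zero[of z] by linarith
    have "norm x \<le> C * (y \<bullet> y)"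
      using C(2)[of y y] by (simp add: y dot_square_norm power2_eq_square mult.assoc)
    also have "\<dots> \<le> C * (e \<bullet> e)" using le C(1) by simp
    finally show ?thesis .
  qed
  then show ?thesis by (auto simp: bounded_iff)
qed

lemma open_cone_symmetric_cone: "open_cone (symmetric_cone jp) e"
  by unfold_locales
    (use symmetric_cone_add symmetric_cone_scale unit_in_symmetric_cone bounded_unit_interval
      in \<open>auto simp: symmetric_cone_def\<close>)

end

section \<open>Normalizing a multiplication algorithm\<close>

lemma dom_D_eq: "open_cone (symmetric_cone jp) e \<Longrightarrow> dom_D jp e = open_cone.D (symmetric_cone jp) e"
  by (simp add: dom_D_def open_cone.D_def)

lemma cone_group_automorphism:
  assumes "T \<in> cone_group jp"
  shows "bij (blinfun_apply T)" "blinfun_apply T ` symmetric_cone jp = symmetric_cone jp"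
  using assms connected_component_subset unfolding cone_group_def cone_automorphisms_def by blast+

lemma linear_blinfun_apply: "linear (blinfun_apply T)"
  by (simp add: blinfun.bounded_linear_right bounded_linear.linear)

context
  fixes jp :: "'a::euclidean_space \<Rightarrow> 'a \<Rightarrow> 'a" and e :: 'a and w :: "'a \<Rightarrow> 'a \<Rightarrow>\<^sub>L 'a"
  assumes cone: "open_cone (symmetric_cone jp) e"
    and alg: "multiplication_algorithm jp e w"
begin

lemma algorithm_unit: "x \<in> symmetric_cone jp \<Longrightarrow> w x e = x"
  using alg unfolding multiplication_algorithm_def by blast

lemma algorithm_bij: "x \<in> symmetric_cone jp \<Longrightarrow> bij (w x)"
  using alg cone_group_automorphism(1) unfolding multiplication_algorithm_def by blast

lemma algorithm_inv_left: "x \<in> symmetric_cone jp \<Longrightarrow> inv (w x) (w x y) = y"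
  by (simp add: algorithm_bij bij_is_inj)

lemma algorithm_inv_right: "x \<in> symmetric_cone jp \<Longrightarrow> w x (inv (w x) y) = y"
  by (simp add: algorithm_bij bij_is_surj surj_f_inv_f)

lemma algorithm_linear_inv: "x \<in> symmetric_cone jp \<Longrightarrow> linear (inv (w x))"
  by (rule inj_linear_imp_inv_linear[OF linear_blinfun_apply bij_is_inj[OF algorithm_bij]])

lemma algorithm_in_cone_iff:
  assumes x: "x \<in> symmetric_cone jp"
  shows "w x y \<in> symmetric_cone jp \<longleftrightarrow> y \<in> symmetric_cone jp"
proof -
  have "w x ` symmetric_cone jp = symmetric_cone jp"
    using alg x cone_group_automorphism(2) unfolding multiplication_algorithm_def by blast
  then show ?thesis
    using inj_image_mem_iff[OF bij_is_inj[OF algorithm_bij[OF x]], of y "symmetric_cone jp"] by simp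
qed

lemma algorithm_inv_in_cone_iff:
  "x \<in> symmetric_cone jp \<Longrightarrow> inv (w x) y \<in> symmetric_cone jp \<longleftrightarrow> y \<in> symmetric_cone jp"
  using algorithm_in_cone_iff[of x "inv (w x) y"] by (simp add: algorithm_inv_right)

lemma cone_unit: "e \<in> symmetric_cone jp"
  by (rule open_cone.unit_in_cone[OF cone])

lemma algorithm_inv_unit: "inv (w e) e = e"
  using algorithm_inv_left[OF cone_unit, of e] algorithm_unit[OF cone_unit]
  by simp

lemma algorithm_unit_in_D_iff: "w e y \<in> dom_D jp e \<longleftrightarrow> y \<in> dom_D jp e"
proof -
  note e = cone_unit
  have "e - w e y = w e (e - y)" by (simp add: blinfun.diff_right algorithm_unit[OF e])
  then show ?thesis by (simp add: dom_D_def algorithm_in_cone_iff[OF e])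
qed

lemma algorithm_inv_unit_in_D_iff: "inv (w e) y \<in> dom_D jp e \<longleftrightarrow> y \<in> dom_D jp e"
  using algorithm_unit_in_D_iff[of "inv (w e) y"] by (simp add: algorithm_inv_right cone_unit)

definition normalized_mult :: "'a \<Rightarrow> 'a \<Rightarrow> 'a" where
  "normalized_mult x y = w x (inv (w e) y)"

definition normalized_div :: "'a \<Rightarrow> 'a \<Rightarrow> 'a" where
  "normalized_div x y = w e (inv (w x) y)"

text \<open>
Composition with the fixed operator \<open>(w e)\<inverse>\<close> affects operator norms by at most a constant factor, and
\<open>w e\<close> maps the cone onto itself, so continuity at \<open>e\<close> and surjectivity pass to the normalized maps.
\<close>

lemma normalized_algorithm_of:
  assumes hom: "homogeneous_alg jp w"
    and cont: "continuous_at_unit_alg jp e w"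
    and surj: "surjective_division_alg jp e w"
  shows "normalized_algorithm (symmetric_cone jp) e normalized_mult normalized_div"
proof (intro normalized_algorithm.intro normalized_algorithm_axioms.intro cone)
  let ?\<Omega> = "symmetric_cone jp"
  note e = cone_unit
  fix x y :: 'a and s :: real assume x: "x \<in> ?\<Omega>"
  show "linear (normalized_mult x)"
    using linear_compose[OF algorithm_linear_inv[OF e] linear_blinfun_apply]
    by (simp add: normalized_mult_def[abs_def] o_def)
  show "normalized_mult x (normalized_div x y) = y"
    by (simp add: normalized_mult_def normalized_div_def algorithm_inv_left[OF e] algorithm_inv_right[OF x])
  show "normalized_div x (normalized_mult x y) = y"
    by (simp add: normalized_mult_def normalized_div_def algorithm_inv_left[OF x] algorithm_inv_right[OF e])
  show "normalized_mult x y \<in> ?\<Omega> \<longleftrightarrow> y \<in> ?\<Omega>"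
    by (simp add: normalized_mult_def algorithm_in_cone_iff[OF x] algorithm_inv_in_cone_iff[OF e])
  show "normalized_mult x e = x" by (simp add: normalized_mult_def algorithm_inv_unit algorithm_unit[OF x])
  assume "0 < s"
  then show "normalized_mult (s *\<^sub>R x) y = s *\<^sub>R normalized_mult x y"
    using hom x by (simp add: normalized_mult_def homogeneous_alg_def blinfun.scaleR_left)
next
  fix y show "normalized_mult e y = y"
    by (simp add: normalized_mult_def algorithm_inv_right[OF cone_unit])
next
  let ?\<Omega> = "symmetric_cone jp"
  note e = cone_unit
  fix r :: real assume r: "0 < r"
  obtain M where M: "M > 0" "\<And>y. norm (inv (w e) y) \<le> norm y * M"
    using bounded_linear.pos_bounded algorithm_linear_inv[OF e] unfolding linear_conv_bounded_linear by blast
  have "r / M > 0" using r M by simp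
  then have "\<forall>\<^sub>F x in at e within ?\<Omega>. dist (w x) (w e) < r / M"
    using cont unfolding continuous_at_unit_alg_def by (rule tendstoD[rotated])
  then obtain d where d: "d > 0" "\<And>x. x \<in> ?\<Omega> \<Longrightarrow> x \<noteq> e \<Longrightarrow> dist x e < d \<Longrightarrow> dist (w x) (w e) < r / M"
    unfolding eventually_at by blast
  have "norm (normalized_mult x y - y) \<le> r * norm y" if x: "x \<in> ?\<Omega>" "dist x e < d" for x y
  proof -
    have close: "norm (w x - w e) \<le> r / M"
      using d(2)[OF x(1) _ x(2)] \<open>r / M > 0\<close> by (cases "x = e") (auto simp: dist_norm)
    have "normalized_mult x y - y = (w x - w e) (inv (w e) y)"
      by (simp add: normalized_mult_def blinfun.diff_left algorithm_inv_right[OF e])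
    also have "norm \<dots> \<le> norm (w x - w e) * norm (inv (w e) y)" by (rule norm_blinfun)
    also have "\<dots> \<le> r / M * (norm y * M)"
      using \<open>r / M > 0\<close> by (intro mult_mono close M) auto
    finally show ?thesis using M(1) by simp
  qed
  then show "\<exists>d>0. \<forall>x\<in>?\<Omega>. dist x e < d \<longrightarrow> (\<forall>y. norm (normalized_mult x y - y) \<le> r * norm y)"
    using d(1) by blast
next
  let ?\<Omega> = "symmetric_cone jp"
  note e = cone_unit
  fix z assume z: "z \<in> ?\<Omega>"
  then have "inv (w e) z \<in> (\<lambda>x. division_algorithm w x e) ` ?\<Omega>"
    using surj algorithm_inv_in_cone_iff[OF e] unfolding surjective_division_alg_def by simp
  then obtain x where x: "x \<in> ?\<Omega>" "inv (w e) z = division_algorithm w x e" by blast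
  have "normalized_div x e = z"
    using x(2) algorithm_inv_right[OF e, of z]
    by (simp add: normalized_div_def blinfun_apply_division_algorithm[of w, OF algorithm_bij[OF x(1)]])
  then show "\<exists>x\<in>?\<Omega>. normalized_div x e = z" using x(1) by blast
qed

lemma inv_unit_normalized_div:
  "x \<in> symmetric_cone jp \<Longrightarrow> inv (w e) (normalized_div x y) = division_algorithm w x y"
  by (simp add: normalized_div_def algorithm_inv_left cone_unit
      blinfun_apply_division_algorithm[OF algorithm_bij])

lemma logarithmic_if_is_log:
  assumes "\<And>x y. x \<in> symmetric_cone jp \<Longrightarrow> y \<in> symmetric_cone jp \<Longrightarrow> N (normalized_mult x y) = N x + N y"
  shows "logarithmic jp e w N"
  unfolding logarithmic_def
proof (intro ballI)
  note e = cone_unit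
  fix x y assume "x \<in> symmetric_cone jp" "y \<in> symmetric_cone jp"
  then have "N (normalized_mult x (w e y)) = N x + N (w e y)"
    using algorithm_in_cone_iff[OF e] by (intro assms) auto
  then show "N x + N (w e y) = N (w x y)"
    by (simp add: normalized_mult_def algorithm_inv_left[OF e])
qed

lemma continuous_on_D_compose_inv:
  assumes "continuous_on (dom_D jp e) g"
  shows "continuous_on (dom_D jp e) (\<lambda>y. g (inv (w e) y))"
proof (rule continuous_on_compose2[OF assms])
  show "continuous_on (dom_D jp e) (inv (w e))"
    using algorithm_linear_inv[OF cone_unit]
    by (simp add: linear_continuous_on linear_conv_bounded_linear)
qed (auto simp: algorithm_inv_unit_in_D_iff)

end

theorem theorem3p5:
  fixes jp :: "'a::euclidean_space \<Rightarrow> 'a \<Rightarrow> 'a"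
    and e :: 'a
    and w w' :: "'a \<Rightarrow> 'a \<Rightarrow>\<^sub>L 'a"
    and f g h k :: "'a \<Rightarrow> real"
  assumes "simple_euclidean_jordan_algebra jp e"
    and "multiplication_algorithm jp e w"
    and "homogeneous_alg jp w"
    and "continuous_at_unit_alg jp e w"
    and "surjective_division_alg jp e w"
    and "multiplication_algorithm jp e w'"
    and "homogeneous_alg jp w'"
    and "continuous_at_unit_alg jp e w'"
    and "surjective_division_alg jp e w'"
    and "continuous_on (dom_D jp e) f"
    and "continuous_on (dom_D jp e) g"
    and "continuous_on (dom_D jp e) h"
    and "continuous_on (dom_D jp e) k"
    and "\<forall>(x, y) \<in> dom_D0 jp e.
           f x + g (blinfun_apply (division_algorithm w (e - x)) y) =
           h y + k (blinfun_apply (division_algorithm w' (e - y)) x)"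
  shows "\<exists>C1 C2 C3 C4 :: real. \<exists>h1 h2 h3 :: 'a \<Rightarrow> real.
           C1 + C2 = C3 + C4 \<and>
           continuous_on (symmetric_cone jp) h1 \<and>
           continuous_on (symmetric_cone jp) h2 \<and>
           continuous_on (symmetric_cone jp) h3 \<and>
           logarithmic jp e w h1 \<and> logarithmic jp e w' h1 \<and>
           logarithmic jp e w' h2 \<and>
           logarithmic jp e w h3 \<and>
           (\<forall>x \<in> dom_D jp e.
              f x = h1 (e - x) + h2 x + h3 (e - x) + C1 \<and>
              g x = h1 (e - blinfun_apply (w e) x) + h3 (blinfun_apply (w e) x) + C2 \<and>
              h x = h1 (e - x) + h2 (e - x) + h3 x + C3 \<and>
              k x = h1 (e - blinfun_apply (w' e) x) + h2 (blinfun_apply (w' e) x) + C4)"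
proof -
  let ?\<Omega> = "symmetric_cone jp"
  interpret jordan_algebra jp e
    using assms(1) by unfold_locales (simp add: simple_euclidean_jordan_algebra_def)
  note cone = open_cone_symmetric_cone
  note alg = assms(2) and alg' = assms(6)
  let ?W = "normalized_mult e w" and ?V = "normalized_div e w"
  let ?W' = "normalized_mult e w'" and ?V' = "normalized_div e w'"
  note norm = normalized_algorithm_of[OF cone alg assms(3-5)]
  note norm' = normalized_algorithm_of[OF cone alg' assms(7-9)]
  interpret two_algorithms ?\<Omega> e ?W ?V ?W' ?V'
    by (intro two_algorithms.intro cone norm norm')
  interpret swap: two_algorithms ?\<Omega> e ?W' ?V' ?W ?V
    by (intro two_algorithms.intro cone norm norm')
  have D: "dom_D jp e = D" by (rule dom_D_eq[OF cone])
  define G where "G y = g (inv (w e) y)" for y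
  define K where "K y = k (inv (w' e) y)" for y
  have cont: "continuous_on D f" "continuous_on D h" "continuous_on D G" "continuous_on D K"
    using assms(10,12) continuous_on_D_compose_inv[OF cone alg assms(11)]
      continuous_on_D_compose_inv[OF cone alg' assms(13)]
    unfolding D G_def[abs_def] K_def[abs_def] by auto
  have eq: "f x + G (?V (e - x) y) = h y + K (?V' (e - y) x)"
    if "x \<in> D" "y \<in> D" "x + y \<in> D" for x y
  proof -
    have "(x, y) \<in> dom_D0 jp e" using that by (simp add: dom_D0_def D)
    moreover have "e - x \<in> ?\<Omega>" "e - y \<in> ?\<Omega>" using that by (simp_all add: D_iff)
    ultimately show ?thesis
      using assms(14) by (auto simp: G_def K_def inv_unit_normalized_div[OF cone alg]
          inv_unit_normalized_div[OF cone alg'])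
  qed
  obtain N3 c where N3: "continuous_on ?\<Omega> N3" "A1.is_log N3"
    and f: "\<And>x. x \<in> D \<Longrightarrow> f x = K x + c + N3 (e - x)"
    using unmatched_pair_differs_by_log[OF cont(1,4) eq] by blast
  have "h y + K (?V' (e - y) x) = f x + G (?V (e - x) y)"
    if "y \<in> D" "x \<in> D" "y + x \<in> D" for x y
    using eq[of x y] that by (simp add: add.commute)
  then obtain N2 c' where N2: "continuous_on ?\<Omega> N2" "A2.is_log N2"
    and h: "\<And>y. y \<in> D \<Longrightarrow> h y = G y + c' + N2 (e - y)"
    using swap.unmatched_pair_differs_by_log[OF cont(2,3)] by blast
  define A where "A u = G (e - u) - N3 (e - u)" for u
  define B where "B u = K (e - u) - N2 (e - u)" for u
  have cont_reflect: "continuous_on D (\<lambda>u. F (e - u) - N (e - u))"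
    if F: "continuous_on D F" and N: "continuous_on ?\<Omega> N" for F N :: "'a \<Rightarrow> real"
  proof -
    have c: "continuous_on D (\<lambda>u. e - u)" by (intro continuous_intros)
    have "(\<lambda>u. e - u) ` D \<subseteq> D" "(\<lambda>u. e - u) ` D \<subseteq> ?\<Omega>"
      by (auto simp: D_iff)
    from continuous_on_compose2[OF F c this(1)] continuous_on_compose2[OF N c this(2)]
    show ?thesis by (rule continuous_on_diff)
  qed
  interpret symmetric_equation ?\<Omega> e ?W ?V ?W' ?V' A B "c - c'"
  proof (intro symmetric_equation.intro symmetric_equation_axioms.intro two_algorithms_axioms)
    show "continuous_on D A" "continuous_on D B"
      unfolding A_def[abs_def] B_def[abs_def]
      by (intro cont_reflect cont(3,4) N2(1) N3(1))+
    fix u v assume u: "u \<in> D" and v: "v \<in> D" and \<sigma>: "u + v - e \<in> ?\<Omega>"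
    define x y where "x = e - u" and "y = e - v"
    have xy: "x \<in> D" "y \<in> D" "x \<in> ?\<Omega>" "y \<in> ?\<Omega>" "u \<in> ?\<Omega>" "v \<in> ?\<Omega>"
      using u v by (auto simp: x_def y_def D_iff)
    have "e - (x + y) = u + v - e" by (simp add: x_def y_def)
    then have "x + y \<in> D" using \<sigma> xy cone_add by (simp add: D_iff)
    from eq[OF xy(1,2) this]
    have "f x + G (?V u y) = h y + K (?V' v x)" by (simp add: x_def y_def)
    moreover have "e - ?V u (u + v - e) = ?V u y"
      using xy(5) by (simp add: y_def A1.V_diff A1.V_add A1.V_self)
    then have "A (?V u (u + v - e)) = G (?V u y) - (N3 y - N3 u)"
      using A1.log_V[OF N3(2) xy(5,4)] by (simp add: A_def)
    moreover have "e - ?V' v (u + v - e) = ?V' v x"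
      using xy(6) by (simp add: x_def A2.V_diff A2.V_add A2.V_self)
    then have "B (?V' v (u + v - e)) = K (?V' v x) - (N2 x - N2 v)"
      using A2.log_V[OF N2(2) xy(6,3)] by (simp add: B_def)
    moreover have "f x = K x + c + N3 u" "h y = G y + c' + N2 v"
      using f[OF xy(1)] h[OF xy(2)] by (simp_all add: x_def y_def)
    moreover have "A v = G y - N3 y" "B u = K x - N2 x"
      by (simp_all add: A_def B_def x_def y_def)
    ultimately show "B u + A (?V u (u + v - e)) + (c - c') = A v + B (?V' v (u + v - e))"
      by simp
  qed
  obtain H B0 where H: "continuous_on ?\<Omega> H" "A1.is_log H" "A2.is_log H"
    and A: "\<And>x. x \<in> D \<Longrightarrow> A x = A0 + H x" and B: "\<And>x. x \<in> D \<Longrightarrow> B x = B0 + H x"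
    using common_log by blast
  have G: "G y = A0 + H (e - y) + N3 y" if "y \<in> D" for y
    using A[OF D_complement[OF that]] by (simp add: A_def)
  have K: "K x = B0 + H (e - x) + N2 x" if "x \<in> D" for x
    using B[OF D_complement[OF that]] by (simp add: B_def)
  have log: "logarithmic jp e w N" if "A1.is_log N" for N
    using that by (intro logarithmic_if_is_log[OF cone alg]) (simp add: A1.is_log_def)
  have log': "logarithmic jp e w' N" if "A2.is_log N" for N
    using that by (intro logarithmic_if_is_log[OF cone alg']) (simp add: A2.is_log_def)
  have "f x = H (e - x) + N2 x + N3 (e - x) + (B0 + c) \<and>
      g x = H (e - w e x) + N3 (w e x) + A0 \<and>
      h x = H (e - x) + N2 (e - x) + N3 x + (A0 + c') \<and>
      k x = H (e - w' e x) + N2 (w' e x) + B0" if x: "x \<in> dom_D jp e" for x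
  proof -
    have "w e x \<in> D" "w' e x \<in> D"
      using x algorithm_unit_in_D_iff[OF cone alg] algorithm_unit_in_D_iff[OF cone alg']
      by (simp_all add: D)
    then have "g x = A0 + H (e - w e x) + N3 (w e x)" "k x = B0 + H (e - w' e x) + N2 (w' e x)"
      using G[of "w e x"] K[of "w' e x"] algorithm_inv_left[OF cone alg unit_in_cone]
        algorithm_inv_left[OF cone alg' unit_in_cone]
      by (simp_all add: G_def K_def)
    then show ?thesis using f[of x] h[of x] G[of x] K[of x] x by (simp add: D)
  qed
  moreover have "(B0 + c) + A0 = (A0 + c') + B0" using d_zero by simp
  ultimately show ?thesis
    using H(1) N2(1) N3(1) log[OF H(2)] log'[OF H(3)] log'[OF N2(2)] log[OF N3(2)] by blast
qed

end
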